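(* Let $(u,r)$ be an exact solution pair of $$u_t+\mathcal L^su=r(t)f(t,x)\ \text{ in }(0,T]\times(0,l),\quad u(0,\cdot)=\varphi,\quad u(t,0)=u(t,l)=0,\quad \int_0^lu(t,x)\omega(x)\,dx=w(t)\ (0\le t\le T),$$ with $u$ sufficiently regular (in the sense specified in the context). Assume the following, with all constants independent of $h$ and $\tau$. (1) $\sup_{0\le t\le T}\left(\|(u_{ttt}(t))_h\|_h+\|((rf)_{tt}(t))_h\|_h\right)\le C_t$. (2) $\|A_hv_h-(\mathcal L^sv)_h\|_h\le C_vh^2$ for $v=u(t,\cdot)$, uniformly in $0\le t\le T$. (3) $|(f(t),\omega)_{L^2}|\ge\kappa_0>0$ for $0\le t\le T$. (4) $\left|\langle F^{n+\frac12},\boldsymbol\omega\rangle_h-(f(t_{n+\frac12}),\omega)_{L^2}\right|\le C_Qh^2$ uniformly in $n$. (5) $\sup_h\|A_h\boldsymbol\omega\|_h\le C_\omega$ and $\sup_{n,h}\|F^{n+\frac12}\|_h\le C_F$. (6) $w\in C^3[0,T]$. (7) The derivative approximation satisfies $\left|z^{n+\frac12}-w'(t_{n+\frac12})\right|\le\eta$ for $n=0,\dots,M-1$. (8) $\left|w'(t)-\left\langle(u_t(t,x_i))_{i=1}^{N-1},\boldsymbol\omega\right\rangle_h\right|\le C_Qh^2$ for $0\le t\le T$. Let $(U^n)_{n=0}^M$ and $(r_h^{n+\frac12})_{n=0}^{M-1}$ be produced by the reconstruction algorithm described in the context, started from $U^0=u_h^0$ and using the values $z^{n+\frac12}$. Then,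 for sufficiently small $h$ and $\tau$, there exists a constant $C>0$, independent of $h$, $\tau$ and $\eta$, such that $$\max_{0\le n\le M}\|u_h^n-U^n\|_h+\max_{0\le n\le M-1}\left|r(t_{n+\frac12})-r_h^{n+\frac12}\right|\le C(\tau^2+h^2+\eta).$$
   Context: Let $l,T>0$, $0<s<1$. $\mathcal L=-d^2/dx^2$ with domain $H^2(0,l)\cap H^1_0(0,l)$ is the Dirichlet Laplacian on $L^2(0,l)$, with eigenpairs $\phi_k(x)=\sqrt{2/l}\,\sin(k\pi x/l)$, $\lambda_k=(k\pi/l)^2$. The spectral fractional Laplacian is $\mathcal L^sv=\sum_{k\ge1}\lambda_k^s(v,\phi_k)_{L^2}\phi_k$ with domain $D(\mathcal L^s)=\{v\in L^2(0,l):\sum_k\lambda_k^{2s}|(v,\phi_k)_{L^2}|^2<\infty\}$. $f$, $\varphi$, $\omega$, $w$ are given; $f(t)=f(t,\cdot)$; $f$ and $\omega$ have well-defined point values. Discretisation: for integers $N\ge2$, $M\ge1$ put $h=l/N$, $x_i=ih$, $\tau=T/M$, $t_n=n\tau$, $t_{n+\frac12}=(t_n+t_{n+1})/2$. For a continuous function $v$, $v_h=(v(x_1),\dots,v(x_{N-1}))^T$; $u_h^n=(u(t_n,\cdot))_h$; $F^{n+\frac12}=(f(t_{n+\frac12},x_i))_{i=1}^{N-1}$; $\boldsymbol\omega=(\omega(x_i))_{i=1}^{N-1}$. On $\mathbb R^{N-1}$: $\langle v,z\rangle_h=h\sum_{i=1}^{N-1}v_iz_i$, $\|v\|_h^2=\langle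 v,v\rangle_h$. $L_h=\frac1{h^2}\,\mathrm{tridiag}(-1,2,-1)\in\mathbb R^{(N-1)\times(N-1)}$ has the spectral decomposition $L_h=Q\Lambda_hQ^T$ with $Q_{ik}=\sqrt{2/N}\,\sin(ik\pi/N)$, $\Lambda_h=\mathrm{diag}(\lambda_{k,h})$, $\lambda_{k,h}=\frac4{h^2}\sin^2\left(\frac{k\pi}{2N}\right)$, and $A_h:=L_h^s=Q\Lambda_h^sQ^T$. Reconstruction algorithm: let $L=I+\frac\tau2A_h$, $R=I-\frac\tau2A_h$, and let $z^{n+\frac12}\in\mathbb R$, $n=0,\dots,M-1$, be given approximations of $w'(t_{n+\frac12})$. Start with $U^0=(\varphi(x_i))_{i=1}^{N-1}=u_h^0$. For $n=0,\dots,M-1$ compute $$Y=L^{-1}RU^n,\quad S=L^{-1}F^{n+\frac12},\quad V=\tfrac12(U^n+Y),\quad r_h^{n+\frac12}=\frac{z^{n+\frac12}+\langle A_hV,\boldsymbol\omega\rangle_h}{\langle S,\boldsymbol\omega\rangle_h},\quad U^{n+1}=Y+\tau r_h^{n+\frac12}S .$$ (Under the hypotheses the denominators are nonzero for sufficiently small $h,\tau$.) "Sufficiently regular" means: for every $t\in[0,T]$, $u(t,\cdot)\in D(\mathcal L^s)$, and $u(t,\cdot)$, $u_t(t,\cdot)$, $r(t)f(t,\cdot)$ and $\mathcal L^su(t,\cdot)$ are represented by continuous functions; the equation $u_t+\mathcal L^su=rf$ holds pointwise at every $t\in[0,T]$ and $x\in(0,l)$; and for each $x$, $t\mapsto u(t,x)$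 is three times and $t\mapsto r(t)f(t,x)$ twice continuously differentiable on $[0,T]$. "For sufficiently small $h$ and $\tau$": there are thresholds $h_0,\tau_0>0$, independent of $\eta$, such that the estimate holds whenever $h\le h_0$, $\tau\le\tau_0$. *)

theory Defs
  imports
    "HOL-Analysis.Analysis"
    "Jordan_Normal_Form.Gauss_Jordan_Elimination"
begin

hide_type (open) Finite_Cartesian_Product.vec
hide_const (open) Finite_Cartesian_Product.vec

text \<open>Functions in \<open>L\<^sup>2(0,l)\<close> are real functions on the whole line of which only the values
  on the open interval matter.\<close>

definition L2_on :: "real \<Rightarrow> (real \<Rightarrow> real) set" where
  "L2_on l = {v. v \<in> borel_measurable (lebesgue_on {0<..<l}) \<and>
                 integrable (lebesgue_on {0<..<l}) (\<lambda>x. (v x)\<^sup>2)}"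

definition L2_inner :: "real \<Rightarrow> (real \<Rightarrow> real) \<Rightarrow> (real \<Rightarrow> real) \<Rightarrow> real" where
  "L2_inner l v z = (\<integral>x. v x * z x \<partial>lebesgue_on {0<..<l})"

definition eigfun :: "real \<Rightarrow> nat \<Rightarrow> real \<Rightarrow> real" where
  "eigfun l k x = sqrt (2 / l) * sin (real k * pi * x / l)"

definition eigval :: "real \<Rightarrow> nat \<Rightarrow> real" where
  "eigval l k = (real k * pi / l)\<^sup>2"

definition frac_dom :: "real \<Rightarrow> real \<Rightarrow> (real \<Rightarrow> real) set" where
  "frac_dom l s = {v \<in> L2_on l.
     summable (\<lambda>k. eigval l (Suc k) powr (2 * s) * (L2_inner l v (eigfun l (Suc k)))\<^sup>2)}"

text \<open>\<open>represents_frac l s v g\<close>: the function \<open>g\<close> is a representative of the \<open>L\<^sup>2\<close> class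
  \<open>\<L>\<^sup>s v\<close>, i.e. the eigenfunction series converges to \<open>g\<close> in \<open>L\<^sup>2(0,l)\<close>.  This determines
  \<open>g\<close> almost everywhere on \<open>(0,l)\<close>, hence everywhere there if \<open>g\<close> is continuous.\<close>

definition represents_frac :: "real \<Rightarrow> real \<Rightarrow> (real \<Rightarrow> real) \<Rightarrow> (real \<Rightarrow> real) \<Rightarrow> bool" where
  "represents_frac l s v g \<longleftrightarrow> v \<in> frac_dom l s \<and> g \<in> L2_on l \<and>
     (\<lambda>K. \<integral>x. (g x - (\<Sum>k=1..K. eigval l k powr s * L2_inner l v (eigfun l k) * eigfun l k x))\<^sup>2
           \<partial>lebesgue_on {0<..<l}) \<longlonglongrightarrow> 0"

text \<open>Derivatives on \<open>[0,T]\<close> are one-sided at the end points; iterating \<open>ivl_deriv\<close> gives the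
  higher derivatives.\<close>

definition ivl_deriv :: "real \<Rightarrow> (real \<Rightarrow> real) \<Rightarrow> real \<Rightarrow> real" where
  "ivl_deriv T g t = vector_derivative g (at t within {0..T})"

definition Ck_on :: "nat \<Rightarrow> real \<Rightarrow> (real \<Rightarrow> real) \<Rightarrow> bool" where
  "Ck_on k T g \<longleftrightarrow>
     (\<forall>j<k. \<forall>t\<in>{0..T}. (ivl_deriv T ^^ j) g differentiable (at t within {0..T})) \<and>
     continuous_on {0..T} ((ivl_deriv T ^^ k) g)"

text \<open>In the next two definitions \<open>Lu t\<close> is the continuous representative of
  \<open>\<L>\<^sup>s u(t,\<cdot>)\<close>; it is pinned down by the clauses of \<open>sufficiently_regular\<close>.\<close>

definition exact_solution ::
  "real \<Rightarrow> real \<Rightarrow> (real \<Rightarrow> real \<Rightarrow> real) \<Rightarrow> (real \<Rightarrow> real) \<Rightarrow> (real \<Rightarrow> real) \<Rightarrow> (real \<Rightarrow> real) \<Rightarrow>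
   (real \<Rightarrow> real \<Rightarrow> real) \<Rightarrow> (real \<Rightarrow> real \<Rightarrow> real) \<Rightarrow> (real \<Rightarrow> real) \<Rightarrow> bool" where
  "exact_solution l T f \<phi> \<omega> w u Lu r \<longleftrightarrow>
     (\<forall>t\<in>{0<..T}. \<forall>x\<in>{0<..<l}. ivl_deriv T (\<lambda>t'. u t' x) t + Lu t x = r t * f t x) \<and>
     (\<forall>x\<in>{0<..<l}. u 0 x = \<phi> x) \<and>
     (\<forall>t\<in>{0..T}. u t 0 = 0 \<and> u t l = 0) \<and>
     (\<forall>t\<in>{0..T}. L2_inner l (u t) \<omega> = w t)"

definition sufficiently_regular ::
  "real \<Rightarrow> real \<Rightarrow> real \<Rightarrow> (real \<Rightarrow> real \<Rightarrow> real) \<Rightarrow>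
   (real \<Rightarrow> real \<Rightarrow> real) \<Rightarrow> (real \<Rightarrow> real \<Rightarrow> real) \<Rightarrow> (real \<Rightarrow> real) \<Rightarrow> bool" where
  "sufficiently_regular l T s f u Lu r \<longleftrightarrow>
     (\<forall>t\<in>{0..T}.
        represents_frac l s (u t) (Lu t) \<and>
        continuous_on {0..l} (u t) \<and>
        continuous_on {0<..<l} (\<lambda>x. ivl_deriv T (\<lambda>t'. u t' x) t) \<and>
        continuous_on {0<..<l} (\<lambda>x. r t * f t x) \<and>
        continuous_on {0<..<l} (Lu t) \<and>
        (\<forall>x\<in>{0<..<l}. ivl_deriv T (\<lambda>t'. u t' x) t + Lu t x = r t * f t x)) \<and>
     (\<forall>x\<in>{0<..<l}. Ck_on 3 T (\<lambda>t. u t x) \<and> Ck_on 2 T (\<lambda>t. r t * f t x))"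

text \<open>Vectors in \<open>\<real>\<^bsup>N-1\<^esup>\<close> are indexed from \<open>0\<close> here, so entry \<open>i\<close> belongs to the grid point
  \<open>x\<^bsub>i+1\<^esub>\<close>, and likewise for matrices.\<close>

definition grid_vec :: "real \<Rightarrow> nat \<Rightarrow> (real \<Rightarrow> real) \<Rightarrow> real vec" where
  "grid_vec l N v = vec (N - 1) (\<lambda>i. v (real (Suc i) * (l / real N)))"

definition inner_h :: "real \<Rightarrow> real vec \<Rightarrow> real vec \<Rightarrow> real" where
  "inner_h h v z = h * scalar_prod v z"

definition norm_h :: "real \<Rightarrow> real vec \<Rightarrow> real" where
  "norm_h h v = sqrt (inner_h h v v)"

definition t_half :: "real \<Rightarrow> nat \<Rightarrow> nat \<Rightarrow> real" where
  "t_half T M n = (real n * (T / real M) + real (Suc n) * (T / real M)) / 2"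

definition Q_mat :: "nat \<Rightarrow> real mat" where
  "Q_mat N = mat (N - 1) (N - 1)
     (\<lambda>(i, k). sqrt (2 / real N) * sin (real (Suc i) * real (Suc k) * pi / real N))"

definition eigval_h :: "real \<Rightarrow> nat \<Rightarrow> nat \<Rightarrow> real" where
  "eigval_h l N k = 4 / (l / real N)\<^sup>2 * (sin (real k * pi / (2 * real N)))\<^sup>2"

text \<open>The matrix \<open>A\<^sub>h = L\<^sub>h\<^sup>s\<close>, where \<open>L\<^sub>h = h\<^bsup>-2\<^esup> tridiag(-1,2,-1)\<close> has the eigenvalues
  \<open>eigval_h\<close> and the orthonormal eigenvectors given by the columns of \<open>Q_mat\<close>.\<close>

definition A_mat :: "real \<Rightarrow> real \<Rightarrow> nat \<Rightarrow> real mat" where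
  "A_mat l s N = Q_mat N *
     mat (N - 1) (N - 1) (\<lambda>(i, k). if i = k then eigval_h l N (Suc k) powr s else 0) *
     transpose_mat (Q_mat N)"

text \<open>The algorithm, for given \<open>h\<close>, \<open>\<tau>\<close>, \<open>A = A\<^sub>h\<close>, \<open>F n = F\<^bsup>n+1/2\<^esup>\<close>, \<open>z n = z\<^bsup>n+1/2\<^esup>\<close> and the
  vector \<open>\<omega>\<close> of values of the weight.  The matrix to be inverted is positive definite for
  \<open>A = A\<^sub>h\<close> and \<open>\<tau> > 0\<close>, so that \<open>mat_inverse\<close> returns its inverse.\<close>

definition left_inv :: "real \<Rightarrow> real mat \<Rightarrow> real mat" where
  "left_inv \<tau> A = the (mat_inverse (1\<^sub>m (dim_row A) + (\<tau> / 2) \<cdot>\<^sub>m A))"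

definition right_mat :: "real \<Rightarrow> real mat \<Rightarrow> real mat" where
  "right_mat \<tau> A = 1\<^sub>m (dim_row A) - (\<tau> / 2) \<cdot>\<^sub>m A"

definition rec_Y :: "real \<Rightarrow> real mat \<Rightarrow> real vec \<Rightarrow> real vec" where
  "rec_Y \<tau> A U = left_inv \<tau> A *\<^sub>v (right_mat \<tau> A *\<^sub>v U)"

definition rec_S :: "real \<Rightarrow> real mat \<Rightarrow> real vec \<Rightarrow> real vec" where
  "rec_S \<tau> A F = left_inv \<tau> A *\<^sub>v F"

definition rec_r ::
  "real \<Rightarrow> real \<Rightarrow> real mat \<Rightarrow> real vec \<Rightarrow> real vec \<Rightarrow> real \<Rightarrow> real vec \<Rightarrow> real" where
  "rec_r h \<tau> A F \<omega> z U =
     (let V = (1 / 2) \<cdot>\<^sub>v (U + rec_Y \<tau> A U)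
      in (z + inner_h h (A *\<^sub>v V) \<omega>) / inner_h h (rec_S \<tau> A F) \<omega>)"

primrec rec_U ::
  "real \<Rightarrow> real \<Rightarrow> real mat \<Rightarrow> (nat \<Rightarrow> real vec) \<Rightarrow> real vec \<Rightarrow> (nat \<Rightarrow> real) \<Rightarrow> real vec \<Rightarrow>
   nat \<Rightarrow> real vec" where
  "rec_U h \<tau> A F \<omega> z U0 0 = U0"
| "rec_U h \<tau> A F \<omega> z U0 (Suc n) =
     (let U = rec_U h \<tau> A F \<omega> z U0 n
      in rec_Y \<tau> A U + (\<tau> * rec_r h \<tau> A (F n) \<omega> (z n) U) \<cdot>\<^sub>v rec_S \<tau> A (F n))"

end

theory Submission
  imports Defs "Jordan_Normal_Form.Determinant"
begin

text \<open>The error \<open>e\<^sup>n = u\<^sub>h\<^sup>n - U\<^sup>n\<close> satisfies a Crank--Nicolson scheme whose source is the sum of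
  \<open>(r - r\<^sub>h) F\<close> and the truncation error.  Positivity of \<open>A\<^sub>h\<close> makes \<open>L\<^sup>-\<^sup>1\<close> and \<open>L\<^sup>-\<^sup>1 R\<close>
  contractions.  Since \<open>V = L\<^sup>-\<^sup>1 U\<^sup>n\<close>, moving \<open>A\<^sub>h\<close> onto the weight bounds the error of \<open>r\<^sub>h\<close> by
  \<open>C\<^sub>\<omega> \<parallel>e\<^sup>n\<parallel>\<close> plus the data errors, divided by \<open>\<langle>S,\<omega>\<rangle>\<close>, which stays above \<open>\<kappa>\<^sub>0/2\<close> because
  \<open>L\<^sup>-\<^sup>1 \<omega> = \<omega> + O(\<tau>)\<close>.  A discrete Gronwall argument closes the estimate.\<close>

section \<open>The discrete inner product\<close>

text \<open>The exact grid values obey the recursion of the algorithm up to a residual, and testing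
  that step with the weight recovers the exact r by the same quotient formula, so the two can simply
  be subtracted. Because V depends on \<open>U n\<close> alone, the error of \<open>rec_r\<close> is
  bounded by the state error at the same time level. The coupling is thus explicit and Gronwall
  works for every step size; h and \<tau> have to be small only for the denominators. Two bounds
  must be manufactured. The norm of the sampled weight is controlled only through its image under
  A_h, so A_h needs a lower bound that is uniform in N; it comes from the orthogonality of the sine
  matrix and the smallest discrete eigenvalue. And no time derivative of \<open>Lu\<close> is given,
  so the averaging error of Crank-Nicolson is expanded for r f - u_t, which equals \<open>Lu\<close>
  by the equation and has two time derivatives.\<close>

lemma inner_h_add_left:
  "v \<in> carrier_vec n \<Longrightarrow> w \<in> carrier_vec n \<Longrightarrow> x \<in> carrier_vec n \<Longrightarrow>
    inner_h h (v + w) x = inner_h h v x + inner_h h w x"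
  by (simp add: inner_h_def add_scalar_prod_distrib algebra_simps)

lemma inner_h_minus_left:
  "v \<in> carrier_vec n \<Longrightarrow> w \<in> carrier_vec n \<Longrightarrow> x \<in> carrier_vec n \<Longrightarrow>
    inner_h h (v - w) x = inner_h h v x - inner_h h w x"
  by (simp add: inner_h_def minus_scalar_prod_distrib algebra_simps)

lemma inner_h_smult_left:
  "v \<in> carrier_vec n \<Longrightarrow> x \<in> carrier_vec n \<Longrightarrow> inner_h h (c \<cdot>\<^sub>v v) x = c * inner_h h v x"
  by (simp add: inner_h_def)

lemma inner_h_commute:
  "v \<in> carrier_vec n \<Longrightarrow> w \<in> carrier_vec n \<Longrightarrow> inner_h h v w = inner_h h w v"
  by (simp add: inner_h_def comm_scalar_prod)

lemma inner_h_add_right: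
  "v \<in> carrier_vec n \<Longrightarrow> w \<in> carrier_vec n \<Longrightarrow> x \<in> carrier_vec n \<Longrightarrow>
    inner_h h x (v + w) = inner_h h x v + inner_h h x w"
  by (simp add: inner_h_def scalar_prod_add_distrib algebra_simps)

lemma inner_h_minus_right:
  "v \<in> carrier_vec n \<Longrightarrow> w \<in> carrier_vec n \<Longrightarrow> x \<in> carrier_vec n \<Longrightarrow>
    inner_h h x (v - w) = inner_h h x v - inner_h h x w"
  by (simp add: inner_h_def scalar_prod_minus_distrib algebra_simps)

lemma inner_h_smult_right:
  "v \<in> carrier_vec n \<Longrightarrow> x \<in> carrier_vec n \<Longrightarrow> inner_h h x (c \<cdot>\<^sub>v v) = c * inner_h h x v"
  by (simp add: inner_h_def)

lemmas inner_h_linear = inner_h_add_left inner_h_minus_left inner_h_smult_left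
  inner_h_add_right inner_h_minus_right inner_h_smult_right

section \<open>The discrete norm: triangle inequality, Cauchy-Schwarz and duality\<close>

lemma norm_h_eq_L2_set: "0 \<le> h \<Longrightarrow> norm_h h v = sqrt h * L2_set (vec_index v) {0..<dim_vec v}"
  by (simp add: norm_h_def inner_h_def scalar_prod_def L2_set_def real_sqrt_mult power2_eq_square)

lemma norm_h_nonneg: "0 \<le> h \<Longrightarrow> 0 \<le> norm_h h v"
  by (simp add: norm_h_eq_L2_set L2_set_nonneg)

lemma inner_h_self: "0 \<le> h \<Longrightarrow> inner_h h v v = (norm_h h v)\<^sup>2"
  by (simp add: norm_h_def inner_h_def scalar_prod_def sum_nonneg)

lemma norm_h_smult: "norm_h h (c \<cdot>\<^sub>v v) = \<bar>c\<bar> * norm_h h v"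
proof -
  have "inner_h h (c \<cdot>\<^sub>v v) (c \<cdot>\<^sub>v v) = c\<^sup>2 * inner_h h v v"
    by (simp add: inner_h_def power2_eq_square)
  then show ?thesis by (simp add: norm_h_def real_sqrt_mult)
qed

lemma norm_h_triangle:
  assumes "0 \<le> h" "v \<in> carrier_vec n" "w \<in> carrier_vec n"
  shows "norm_h h (v + w) \<le> norm_h h v + norm_h h w"
proof -
  have "L2_set (vec_index (v + w)) {0..<n} = L2_set (\<lambda>i. vec_index v i + vec_index w i) {0..<n}"
    using assms by (intro L2_set_cong) auto
  also have "\<dots> \<le> L2_set (vec_index v) {0..<n} + L2_set (vec_index w) {0..<n}"
    by (rule L2_set_triangle_ineq)
  finally show ?thesis
    using assms by (simp add: norm_h_eq_L2_set mult_left_mono flip: distrib_left)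
qed

lemma norm_h_triangle_minus:
  assumes "0 \<le> h" "v \<in> carrier_vec n" "w \<in> carrier_vec n"
  shows "norm_h h (v - w) \<le> norm_h h v + norm_h h w"
proof -
  have "v - w = v + (-1) \<cdot>\<^sub>v w" using assms by auto
  then show ?thesis using norm_h_triangle[of h v n "(-1) \<cdot>\<^sub>v w"] assms
    by (simp add: norm_h_smult)
qed

lemma inner_h_Cauchy_Schwarz:
  assumes "0 \<le> h" "v \<in> carrier_vec n" "w \<in> carrier_vec n"
  shows "\<bar>inner_h h v w\<bar> \<le> norm_h h v * norm_h h w"
proof -
  have "\<bar>\<Sum>i\<in>{0..<n}. vec_index v i * vec_index w i\<bar>
      \<le> (\<Sum>i\<in>{0..<n}. \<bar>vec_index v i\<bar> * \<bar>vec_index w i\<bar>)"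
    by (simp add: sum_abs flip: abs_mult)
  also have "\<dots> \<le> L2_set (vec_index v) {0..<n} * L2_set (vec_index w) {0..<n}"
    by (rule L2_set_mult_ineq)
  finally have "h * \<bar>\<Sum>i\<in>{0..<n}. vec_index v i * vec_index w i\<bar>
      \<le> h * (L2_set (vec_index v) {0..<n} * L2_set (vec_index w) {0..<n})"
    using assms by (intro mult_left_mono)
  moreover have "sqrt h * a * (sqrt h * b) = h * (a * b)" for a b
    using assms(1) by (simp add: algebra_simps flip: power2_eq_square)
  ultimately show ?thesis
    using assms by (simp only: norm_h_eq_L2_set inner_h_def scalar_prod_def abs_mult carrier_vecD)
qed

text \<open>Testing with z = v gives the claim after division by the norm. It turns vector estimates
  into scalar ones, which is how a Taylor remainder is bounded in the discrete norm below.\<close>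

lemma norm_h_le_dual:
  assumes h: "0 \<le> h" and "0 \<le> K" and "v \<in> carrier_vec n"
    and "\<And>z. z \<in> carrier_vec n \<Longrightarrow> \<bar>inner_h h v z\<bar> \<le> K * norm_h h z"
  shows "norm_h h v \<le> K"
proof (rule ccontr)
  assume "\<not> norm_h h v \<le> K"
  moreover have "norm_h h v * norm_h h v \<le> K * norm_h h v"
    using assms(4)[OF assms(3)] by (simp add: inner_h_self[OF h] power2_eq_square)
  ultimately show False using assms(2) by (simp add: mult_le_cancel_right)
qed

section \<open>Stability of the Crank--Nicolson step\<close>

text \<open>Here a, b stand for L^-1 x, L^-1 y, and c, d for L^-1 applied to the source and to the
  residual; r and q are the exact and the computed source strength.\<close>

lemma step_difference:
  fixes x y a b c d :: "real vec"
  assumes "x \<in> carrier_vec n" "y \<in> carrier_vec n" "a \<in> carrier_vec n" "b \<in> carrier_vec n"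
    "c \<in> carrier_vec n" "d \<in> carrier_vec n"
  shows "2 \<cdot>\<^sub>v a - x + (t * r) \<cdot>\<^sub>v c + t \<cdot>\<^sub>v d - (2 \<cdot>\<^sub>v b - y + (t * q) \<cdot>\<^sub>v c)
    = (2 \<cdot>\<^sub>v (a - b) - (x - y)) + ((t * (r - q)) \<cdot>\<^sub>v c + t \<cdot>\<^sub>v d)"
  using assms by (auto intro!: eq_vecI simp: field_simps)

text \<open>With y = L^-1 x and a = A y, the relation between x and y turns 2 y - 2 x into -t a, so
  the factor 1 / t cancels and the difference quotient is left without any power of t.\<close>

lemma step_increment:
  fixes x x1 y a c d :: "real vec"
  assumes "y \<in> carrier_vec n" "a \<in> carrier_vec n" "c \<in> carrier_vec n" "d \<in> carrier_vec n"
    and x: "x = y + (t / 2) \<cdot>\<^sub>v a"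
    and x1: "x1 = 2 \<cdot>\<^sub>v y - x + (t * r) \<cdot>\<^sub>v c + t \<cdot>\<^sub>v d"
    and "t \<noteq> 0"
  shows "(1 / t) \<cdot>\<^sub>v (x1 - x) = r \<cdot>\<^sub>v c + d - a"
  unfolding x1 unfolding x using assms(1-4,7) by (auto intro!: eq_vecI simp: field_simps)

text \<open>Symmetry and semidefiniteness are required only as properties of the pairing, so the
  stability argument never sees the spectral construction of A_h.\<close>

locale crank_nicolson =
  fixes m :: nat and h \<tau> :: real and A :: "real mat"
  assumes h: "0 < h" and \<tau>: "0 < \<tau>"
    and A: "A \<in> carrier_mat m m"
    and A_sym: "\<And>x y. x \<in> carrier_vec m \<Longrightarrow> y \<in> carrier_vec m \<Longrightarrow>
      inner_h h (A *\<^sub>v x) y = inner_h h x (A *\<^sub>v y)"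
    and A_psd: "\<And>x. x \<in> carrier_vec m \<Longrightarrow> 0 \<le> inner_h h (A *\<^sub>v x) x"
begin

abbreviation P where "P \<equiv> left_inv \<tau> A"

lemma left_mult:
  assumes "x \<in> carrier_vec m"
  shows "(1\<^sub>m m + (\<tau> / 2) \<cdot>\<^sub>m A) *\<^sub>v x = x + (\<tau> / 2) \<cdot>\<^sub>v (A *\<^sub>v x)"
proof -
  have "(1\<^sub>m m + (\<tau> / 2) \<cdot>\<^sub>m A) *\<^sub>v x = 1\<^sub>m m *\<^sub>v x + ((\<tau> / 2) \<cdot>\<^sub>m A) *\<^sub>v x"
    using A assms by (intro add_mult_distrib_mat_vec) auto
  also have "((\<tau> / 2) \<cdot>\<^sub>m A) *\<^sub>v x = (\<tau> / 2) \<cdot>\<^sub>v (A *\<^sub>v x)"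
    using A assms by (intro eq_vecI) auto
  finally show ?thesis using assms by simp
qed

text \<open>The cross term of the expanded square is nonnegative for the sum and changes sign for
  the difference. The vector y plays the role of L^-1 x, but the form without the inverse is
  available before L is known to be invertible.\<close>

lemma resolvent_contraction:
  assumes y: "y \<in> carrier_vec m"
  shows "norm_h h y \<le> norm_h h (y + (\<tau> / 2) \<cdot>\<^sub>v (A *\<^sub>v y))"
    and "norm_h h (y - (\<tau> / 2) \<cdot>\<^sub>v (A *\<^sub>v y)) \<le> norm_h h (y + (\<tau> / 2) \<cdot>\<^sub>v (A *\<^sub>v y))"
proof -
  define a where "a = (\<tau> / 2) \<cdot>\<^sub>v (A *\<^sub>v y)"
  have [simp]: "a \<in> carrier_vec m" using A y by (auto simp: a_def)
  have ay: "0 \<le> inner_h h a y"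
    using A y A_psd[OF y] \<tau> by (simp add: a_def inner_h_smult_left[of _ m])
  have "inner_h h y y \<le> inner_h h (y + a) (y + a)"
    using ay y inner_h_self[of h a] h
    by (simp add: inner_h_linear[of _ m] inner_h_commute[of y m a])
  then show "norm_h h y \<le> norm_h h (y + a)" by (simp add: norm_h_def)
  have "inner_h h (y - a) (y - a) \<le> inner_h h (y + a) (y + a)"
    using ay y by (simp add: inner_h_linear[of _ m] inner_h_commute[of y m a])
  then show "norm_h h (y - a) \<le> norm_h h (y + a)" by (simp add: norm_h_def)
qed

text \<open>By the first contraction L v = 0 forces v = 0, so the determinant is nonzero. Hence
  \<open>mat_inverse\<close> returns \<open>Some\<close> and the \<open>the\<close> in
  \<open>left_inv\<close> picks a genuine two-sided inverse.\<close>

lemma left_inv_inverse: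
  "P \<in> carrier_mat m m" "(1\<^sub>m m + (\<tau> / 2) \<cdot>\<^sub>m A) * P = 1\<^sub>m m" "P * (1\<^sub>m m + (\<tau> / 2) \<cdot>\<^sub>m A) = 1\<^sub>m m"
proof -
  let ?L = "1\<^sub>m m + (\<tau> / 2) \<cdot>\<^sub>m A"
  have L: "?L \<in> carrier_mat m m" using A by auto
  have "Determinant.det ?L \<noteq> 0"
  proof
    assume "Determinant.det ?L = 0"
    then obtain v where v: "v \<in> carrier_vec m" "v \<noteq> 0\<^sub>v m" "?L *\<^sub>v v = 0\<^sub>v m"
      using det_0_iff_vec_prod_zero_field[OF L] by auto
    then have "norm_h h v \<le> norm_h h (0\<^sub>v m)"
      using resolvent_contraction(1)[OF v(1)] left_mult[OF v(1)] by simp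
    then have "inner_h h v v \<le> 0"
      using h by (simp add: norm_h_def inner_h_def)
    then have "(\<Sum>i\<in>{0..<m}. (vec_index v i)\<^sup>2) \<le> 0"
      using h v(1) by (simp add: inner_h_def scalar_prod_def power2_eq_square mult_le_0_iff)
    then have "(\<Sum>i\<in>{0..<m}. (vec_index v i)\<^sup>2) = 0"
      by (intro antisym sum_nonneg) auto
    then have "v = 0\<^sub>v m"
      using v(1) by (intro eq_vecI) (auto simp: sum_nonneg_eq_0_iff)
    with v show False by simp
  qed
  then have "?L \<in> Units (ring_mat TYPE(real) m ())"
    by (rule det_non_zero_imp_unit[OF L])
  then obtain B where B: "mat_inverse ?L = Some B"
    using mat_inverse(1)[OF L, of "()"] by (cases "mat_inverse ?L") auto
  have "P = B" using B A by (simp add: left_inv_def)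
  with mat_inverse(2)[OF L B]
  show "P \<in> carrier_mat m m" "?L * P = 1\<^sub>m m" "P * ?L = 1\<^sub>m m" by auto
qed

lemma P_carrier [simp]: "x \<in> carrier_vec m \<Longrightarrow> P *\<^sub>v x \<in> carrier_vec m"
  using left_inv_inverse(1) by auto

lemma A_carrier [simp]: "x \<in> carrier_vec m \<Longrightarrow> A *\<^sub>v x \<in> carrier_vec m"
  using A by auto

lemma P_solves: "x \<in> carrier_vec m \<Longrightarrow> P *\<^sub>v x + (\<tau> / 2) \<cdot>\<^sub>v (A *\<^sub>v (P *\<^sub>v x)) = x"
  using left_inv_inverse A left_mult[of "P *\<^sub>v x"]
    assoc_mult_mat_vec[of "1\<^sub>m m + (\<tau> / 2) \<cdot>\<^sub>m A" m m P m x] by simp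

lemma P_unique: "x \<in> carrier_vec m \<Longrightarrow> P *\<^sub>v (x + (\<tau> / 2) \<cdot>\<^sub>v (A *\<^sub>v x)) = x"
  using left_inv_inverse A left_mult[of x]
    assoc_mult_mat_vec[of P m m "1\<^sub>m m + (\<tau> / 2) \<cdot>\<^sub>m A" m x] by simp

lemma P_add: "x \<in> carrier_vec m \<Longrightarrow> y \<in> carrier_vec m \<Longrightarrow> P *\<^sub>v (x + y) = P *\<^sub>v x + P *\<^sub>v y"
  using left_inv_inverse(1) by (rule mult_add_distrib_mat_vec)

lemma P_minus: "x \<in> carrier_vec m \<Longrightarrow> y \<in> carrier_vec m \<Longrightarrow> P *\<^sub>v (x - y) = P *\<^sub>v x - P *\<^sub>v y"
  using left_inv_inverse(1) by (rule mult_minus_distrib_mat_vec)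

lemma P_smult: "x \<in> carrier_vec m \<Longrightarrow> P *\<^sub>v (c \<cdot>\<^sub>v x) = c \<cdot>\<^sub>v (P *\<^sub>v x)"
  using left_inv_inverse(1) by (rule mult_mat_vec)

lemma norm_P: "x \<in> carrier_vec m \<Longrightarrow> norm_h h (P *\<^sub>v x) \<le> norm_h h x"
  using resolvent_contraction(1)[of "P *\<^sub>v x"] P_solves[of x] by simp

text \<open>Substituting x = y + (\<tau>/2) A y with y = L^-1 x turns the reflection into y -
  (\<tau>/2) A y, which the second part of \<open>resolvent_contraction\<close> compares with
  x.\<close>

lemma norm_reflect_P:
  assumes "x \<in> carrier_vec m"
  shows "norm_h h (2 \<cdot>\<^sub>v (P *\<^sub>v x) - x) \<le> norm_h h x"
proof -
  have "2 \<cdot>\<^sub>v (P *\<^sub>v x) - x = P *\<^sub>v x - (\<tau> / 2) \<cdot>\<^sub>v (A *\<^sub>v (P *\<^sub>v x))"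
    by (subst (2) P_solves[OF assms, symmetric])
       (use assms A left_inv_inverse(1) in \<open>auto intro!: eq_vecI\<close>)
  then show ?thesis
    using resolvent_contraction(2)[of "P *\<^sub>v x"] P_solves[of x] assms by simp
qed

text \<open>Since \<open>L + R = 2 I\<close>, the homogeneous step is the reflection \<open>2 L\<^sup>-\<^sup>1 - I\<close>.\<close>

lemma rec_Y_eq:
  assumes "x \<in> carrier_vec m"
  shows "rec_Y \<tau> A x = 2 \<cdot>\<^sub>v (P *\<^sub>v x) - x"
proof -
  have "right_mat \<tau> A *\<^sub>v x = x - (\<tau> / 2) \<cdot>\<^sub>v (A *\<^sub>v x)"
  proof -
    have "right_mat \<tau> A *\<^sub>v x = 1\<^sub>m m *\<^sub>v x - ((\<tau> / 2) \<cdot>\<^sub>m A) *\<^sub>v x"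
      unfolding right_mat_def using A assms by (simp add: minus_mult_distrib_mat_vec[of _ m m])
    also have "((\<tau> / 2) \<cdot>\<^sub>m A) *\<^sub>v x = (\<tau> / 2) \<cdot>\<^sub>v (A *\<^sub>v x)"
      using A assms by (intro eq_vecI) auto
    finally show ?thesis using assms by simp
  qed
  also have "\<dots> = 2 \<cdot>\<^sub>v x - (x + (\<tau> / 2) \<cdot>\<^sub>v (A *\<^sub>v x))"
    using assms A by (auto intro!: eq_vecI)
  finally have "right_mat \<tau> A *\<^sub>v x = \<dots>" .
  then show ?thesis
    using assms by (simp add: rec_Y_def P_minus P_smult P_unique)
qed

lemma rec_Y_carrier [simp]: "x \<in> carrier_vec m \<Longrightarrow> rec_Y \<tau> A x \<in> carrier_vec m"
  by (simp add: rec_Y_eq)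

lemma rec_r_eq:
  assumes "x \<in> carrier_vec m"
  shows "rec_r h \<tau> A F \<omega> z x = (z + inner_h h (A *\<^sub>v (P *\<^sub>v x)) \<omega>) / inner_h h (P *\<^sub>v F) \<omega>"
proof -
  have "(1 / 2) \<cdot>\<^sub>v (x + rec_Y \<tau> A x) = P *\<^sub>v x"
    unfolding rec_Y_eq[OF assms] using assms left_inv_inverse(1) by (auto intro!: eq_vecI)
  then show ?thesis by (simp add: rec_r_def rec_S_def)
qed

lemma rec_U_carrier:
  assumes "\<And>n. F n \<in> carrier_vec m" "U0 \<in> carrier_vec m"
  shows "rec_U h \<tau> A F \<omega> z U0 n \<in> carrier_vec m"
  by (induction n) (use assms in \<open>auto simp: Let_def rec_S_def\<close>)

text \<open>F - L^-1 F equals (\<tau>/2) A L^-1 F: the factor \<tau> costs one application of A.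
  Symmetry passes it to the weight, whose image under A is bounded uniformly in the mesh, so that F
  enters only through its norm.\<close>

lemma denominator_close:
  assumes "F \<in> carrier_vec m" "\<omega> \<in> carrier_vec m"
  shows "\<bar>inner_h h (rec_S \<tau> A F) \<omega> - inner_h h F \<omega>\<bar>
    \<le> \<tau> / 2 * (norm_h h F * norm_h h (A *\<^sub>v \<omega>))"
proof -
  have "F - P *\<^sub>v F = (\<tau> / 2) \<cdot>\<^sub>v (A *\<^sub>v (P *\<^sub>v F))"
    by (subst (1) P_solves[OF assms(1), symmetric]) (use assms A left_inv_inverse(1) in \<open>auto intro!: eq_vecI\<close>)
  then have "inner_h h F \<omega> - inner_h h (P *\<^sub>v F) \<omega> = \<tau> / 2 * inner_h h (P *\<^sub>v F) (A *\<^sub>v \<omega>)"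
    using assms by (simp add: A_sym inner_h_linear[of _ m] flip: inner_h_minus_left[of _ m])
  moreover have "\<bar>inner_h h (P *\<^sub>v F) (A *\<^sub>v \<omega>)\<bar> \<le> norm_h h F * norm_h h (A *\<^sub>v \<omega>)"
    using inner_h_Cauchy_Schwarz[of h "P *\<^sub>v F" m "A *\<^sub>v \<omega>"] assms h norm_P[of F]
    by (smt (verit) A_carrier P_carrier mult_right_mono norm_h_nonneg)
  ultimately show ?thesis
    using \<tau> unfolding rec_S_def abs_minus_commute[of "inner_h h (P *\<^sub>v F) \<omega>"]
    by (simp only: abs_mult) (intro mult_mono, auto)
qed

text \<open>In the application x and x1 are exact grid values at consecutive times, r is the exact
  coefficient at the midpoint, \<rho> is the residual of the scheme, and U is the computed state at
  the time of x.\<close>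

context
  fixes x x1 F \<omega> \<rho> U :: "real vec" and r z :: real
  assumes c: "x \<in> carrier_vec m" "x1 \<in> carrier_vec m" "F \<in> carrier_vec m" "\<omega> \<in> carrier_vec m"
      "\<rho> \<in> carrier_vec m" "U \<in> carrier_vec m"
    and scheme: "(1 / \<tau>) \<cdot>\<^sub>v (x1 - x) + (1 / 2) \<cdot>\<^sub>v (A *\<^sub>v x1 + A *\<^sub>v x) = r \<cdot>\<^sub>v F + \<rho>"
begin

text \<open>Multiplying the scheme by \<tau> and collecting x1 on the left gives L x1 = 2 x - L x +
  \<tau> (r F + \<rho>); applying L^-1 produces the reflection of x.\<close>

lemma perturbed_step: "x1 = rec_Y \<tau> A x + (\<tau> * r) \<cdot>\<^sub>v rec_S \<tau> A F + \<tau> \<cdot>\<^sub>v (P *\<^sub>v \<rho>)"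
proof -
  have *: "x1 + (\<tau> / 2) \<cdot>\<^sub>v (A *\<^sub>v x1)
      = 2 \<cdot>\<^sub>v x - (x + (\<tau> / 2) \<cdot>\<^sub>v (A *\<^sub>v x)) + (\<tau> * r) \<cdot>\<^sub>v F + \<tau> \<cdot>\<^sub>v \<rho>" (is "?l = ?r")
  proof (rule eq_vecI)
    show "dim_vec ?l = dim_vec ?r" using c A by auto
    fix i assume "i < dim_vec ?r"
    then have i: "i < m" using c by auto
    have "vec_index ((1 / \<tau>) \<cdot>\<^sub>v (x1 - x) + (1 / 2) \<cdot>\<^sub>v (A *\<^sub>v x1 + A *\<^sub>v x)) i
        = vec_index (r \<cdot>\<^sub>v F + \<rho>) i" by (simp only: scheme)
    then show "vec_index ?l i = vec_index ?r i"
      using i c A \<tau> by (auto simp add: field_simps)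
  qed
  have "x1 = P *\<^sub>v (x1 + (\<tau> / 2) \<cdot>\<^sub>v (A *\<^sub>v x1))" using c by (simp add: P_unique)
  also have "\<dots> = 2 \<cdot>\<^sub>v (P *\<^sub>v x) - x + (\<tau> * r) \<cdot>\<^sub>v (P *\<^sub>v F) + \<tau> \<cdot>\<^sub>v (P *\<^sub>v \<rho>)"
  proof -
    define q where "q = x + (\<tau> / 2) \<cdot>\<^sub>v (A *\<^sub>v x)"
    have "q \<in> carrier_vec m" "P *\<^sub>v q = x" using c by (auto simp: q_def P_unique)
    then show ?thesis unfolding * q_def[symmetric] using c by (simp add: P_minus P_add P_smult)
  qed
  finally show ?thesis using c by (simp add: rec_Y_eq rec_S_def)
qed

text \<open>The exact r satisfies the quotient formula of the algorithm, with z replaced by the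
  tested difference quotient and a correction by the residual.\<close>

lemma source_identity:
  "r * inner_h h (rec_S \<tau> A F) \<omega>
    = inner_h h ((1 / \<tau>) \<cdot>\<^sub>v (x1 - x)) \<omega> + inner_h h (A *\<^sub>v (P *\<^sub>v x)) \<omega> - inner_h h (P *\<^sub>v \<rho>) \<omega>"
proof -
  have "(1 / \<tau>) \<cdot>\<^sub>v (x1 - x) = r \<cdot>\<^sub>v (P *\<^sub>v F) + P *\<^sub>v \<rho> - A *\<^sub>v (P *\<^sub>v x)"
  proof (rule step_increment[of _ m])
    show "x = P *\<^sub>v x + (\<tau> / 2) \<cdot>\<^sub>v (A *\<^sub>v (P *\<^sub>v x))" using P_solves c by simp
    show "x1 = 2 \<cdot>\<^sub>v (P *\<^sub>v x) - x + (\<tau> * r) \<cdot>\<^sub>v (P *\<^sub>v F) + \<tau> \<cdot>\<^sub>v (P *\<^sub>v \<rho>)"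
      using perturbed_step c by (simp add: rec_Y_eq rec_S_def)
  qed (use c \<tau> in auto)
  then show ?thesis using c by (simp add: inner_h_linear[of _ m] rec_S_def)
qed

text \<open>Subtracting the quotient formulas leaves A L^-1 (x - U) tested with the weight. Moving A
  to the weight avoids an inverse estimate, which would cost a negative power of h. The denominator
  stays as a factor until its lower bound is applied.\<close>

lemma source_error:
  assumes nz: "inner_h h (rec_S \<tau> A F) \<omega> \<noteq> 0"
  shows "\<bar>r - rec_r h \<tau> A F \<omega> z U\<bar> * \<bar>inner_h h (rec_S \<tau> A F) \<omega>\<bar>
    \<le> \<bar>inner_h h ((1 / \<tau>) \<cdot>\<^sub>v (x1 - x)) \<omega> - z\<bar> + norm_h h (x - U) * norm_h h (A *\<^sub>v \<omega>)
      + norm_h h \<rho> * norm_h h \<omega>"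
proof -
  have "(r - rec_r h \<tau> A F \<omega> z U) * inner_h h (rec_S \<tau> A F) \<omega>
      = r * inner_h h (rec_S \<tau> A F) \<omega> - (z + inner_h h (A *\<^sub>v (P *\<^sub>v U)) \<omega>)"
    using nz c by (simp add: rec_r_eq rec_S_def left_diff_distrib)
  also have "\<dots> = inner_h h ((1 / \<tau>) \<cdot>\<^sub>v (x1 - x)) \<omega> - z + inner_h h (P *\<^sub>v (x - U)) (A *\<^sub>v \<omega>)
      - inner_h h (P *\<^sub>v \<rho>) \<omega>"
  proof -
    have "inner_h h (P *\<^sub>v (x - U)) (A *\<^sub>v \<omega>)
        = inner_h h (A *\<^sub>v (P *\<^sub>v x)) \<omega> - inner_h h (A *\<^sub>v (P *\<^sub>v U)) \<omega>"
      using c by (simp add: A_sym P_minus inner_h_minus_left[of _ m])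
    then show ?thesis using source_identity by linarith
  qed
  finally have eq: "(r - rec_r h \<tau> A F \<omega> z U) * inner_h h (rec_S \<tau> A F) \<omega> = \<dots>" .
  have 1: "\<bar>inner_h h (P *\<^sub>v (x - U)) (A *\<^sub>v \<omega>)\<bar> \<le> norm_h h (x - U) * norm_h h (A *\<^sub>v \<omega>)"
    using h c by (intro order_trans[OF inner_h_Cauchy_Schwarz[of h _ m]] mult_right_mono norm_P norm_h_nonneg) auto
  have 2: "\<bar>inner_h h (P *\<^sub>v \<rho>) \<omega>\<bar> \<le> norm_h h \<rho> * norm_h h \<omega>"
    using h c by (intro order_trans[OF inner_h_Cauchy_Schwarz[of h _ m]] mult_right_mono norm_P norm_h_nonneg) auto
  have "\<bar>r - rec_r h \<tau> A F \<omega> z U\<bar> * \<bar>inner_h h (rec_S \<tau> A F) \<omega>\<bar>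
    = \<bar>inner_h h ((1 / \<tau>) \<cdot>\<^sub>v (x1 - x)) \<omega> - z + inner_h h (P *\<^sub>v (x - U)) (A *\<^sub>v \<omega>)
      - inner_h h (P *\<^sub>v \<rho>) \<omega>\<bar>" by (simp only: eq[symmetric] abs_mult)
  with 1 2 show ?thesis by linarith
qed

text \<open>The reflection propagates x - U with factor exactly 1, so all growth enters through |r -
  q|. The strength q is arbitrary here; it becomes the value computed by
  \<open>rec_r\<close>.\<close>

lemma state_error:
  "norm_h h (x1 - (rec_Y \<tau> A U + (\<tau> * q) \<cdot>\<^sub>v rec_S \<tau> A F))
    \<le> norm_h h (x - U) + \<tau> * (\<bar>r - q\<bar> * norm_h h F + norm_h h \<rho>)"
proof -
  let ?E = "2 \<cdot>\<^sub>v (P *\<^sub>v (x - U)) - (x - U)"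
  have "x1 - (rec_Y \<tau> A U + (\<tau> * q) \<cdot>\<^sub>v rec_S \<tau> A F)
      = (2 \<cdot>\<^sub>v (P *\<^sub>v x - P *\<^sub>v U) - (x - U)) + ((\<tau> * (r - q)) \<cdot>\<^sub>v (P *\<^sub>v F) + \<tau> \<cdot>\<^sub>v (P *\<^sub>v \<rho>))"
  proof -
    have "x1 - (rec_Y \<tau> A U + (\<tau> * q) \<cdot>\<^sub>v rec_S \<tau> A F)
      = 2 \<cdot>\<^sub>v (P *\<^sub>v x) - x + (\<tau> * r) \<cdot>\<^sub>v (P *\<^sub>v F) + \<tau> \<cdot>\<^sub>v (P *\<^sub>v \<rho>)
        - (2 \<cdot>\<^sub>v (P *\<^sub>v U) - U + (\<tau> * q) \<cdot>\<^sub>v (P *\<^sub>v F))"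
      using perturbed_step c by (simp add: rec_Y_eq rec_S_def)
    also have "\<dots> = (2 \<cdot>\<^sub>v (P *\<^sub>v x - P *\<^sub>v U) - (x - U)) + ((\<tau> * (r - q)) \<cdot>\<^sub>v (P *\<^sub>v F) + \<tau> \<cdot>\<^sub>v (P *\<^sub>v \<rho>))"
      by (rule step_difference[of _ m]) (use c in auto)
    finally show ?thesis .
  qed
  also have "\<dots> = ?E + ((\<tau> * (r - q)) \<cdot>\<^sub>v (P *\<^sub>v F) + \<tau> \<cdot>\<^sub>v (P *\<^sub>v \<rho>))"
    using c by (simp add: P_minus)
  finally have eq: "x1 - (rec_Y \<tau> A U + (\<tau> * q) \<cdot>\<^sub>v rec_S \<tau> A F) = \<dots>" .
  have "norm_h h (x1 - (rec_Y \<tau> A U + (\<tau> * q) \<cdot>\<^sub>v rec_S \<tau> A F))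
      \<le> norm_h h ?E + norm_h h ((\<tau> * (r - q)) \<cdot>\<^sub>v (P *\<^sub>v F) + \<tau> \<cdot>\<^sub>v (P *\<^sub>v \<rho>))"
    unfolding eq using h c by (intro norm_h_triangle[of h _ m]) auto
  also have "\<dots> \<le> norm_h h ?E + (norm_h h ((\<tau> * (r - q)) \<cdot>\<^sub>v (P *\<^sub>v F)) + norm_h h (\<tau> \<cdot>\<^sub>v (P *\<^sub>v \<rho>)))"
    using h c by (intro add_left_mono norm_h_triangle[of h _ m]) auto
  also have "\<dots> \<le> norm_h h (x - U) + (\<tau> * \<bar>r - q\<bar> * norm_h h F + \<tau> * norm_h h \<rho>)"
    unfolding norm_h_smult using \<tau> c
    by (intro add_mono norm_reflect_P mult_mono norm_P) (auto simp: abs_mult norm_h_nonneg[OF less_imp_le[OF h]])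
  finally show ?thesis by (simp add: algebra_simps)
qed

end

end

section \<open>The discrete fractional Laplacian\<close>

text \<open>Product-to-sum reduces the orthogonality of \<open>Q\<close> to cosine sums, of which only the parity
  of the frequency survives.\<close>

lemma sum_cos_grid:
  assumes "0 < a" "a < 2 * N"
  shows "(\<Sum>k<N - 1. cos (real a * real (Suc k) * pi / real N)) = (- ((-1) ^ a) - 1) / 2"
proof -
  define \<theta> where "\<theta> = real a * pi / real N"
  have N: "0 < N" using assms by simp
  \<comment> \<open>The frequency range is exactly what keeps sin (\<theta>/2) nonzero, so that it
    can be cancelled at the end.\<close>
  have "0 < \<theta> / 2" "\<theta> / 2 < pi"
    using assms N by (auto simp: \<theta>_def field_simps)
  then have s: "sin (\<theta> / 2) > 0" by (rule sin_gt_zero)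
  \<comment> \<open>Multiplied by 2 sin (\<theta>/2), each cosine is a difference of sines at
    neighbouring half-integer multiples of \<theta>, and the sum telescopes.\<close>
  have tele: "2 * sin (\<theta> / 2) * (\<Sum>k<n. cos (real (Suc k) * \<theta>))
      = sin ((real n + 1 / 2) * \<theta>) - sin (\<theta> / 2)" for n
  proof (induction n)
    case (Suc n)
    have "2 * sin (\<theta> / 2) * cos (real (Suc n) * \<theta>)
        = sin ((real (Suc n) + 1 / 2) * \<theta>) - sin ((real n + 1 / 2) * \<theta>)"
    proof -
      have e: "((real (Suc n) + 1 / 2) * \<theta> - (real n + 1 / 2) * \<theta>) / 2 = \<theta> / 2"
        "((real (Suc n) + 1 / 2) * \<theta> + (real n + 1 / 2) * \<theta>) / 2 = real (Suc n) * \<theta>"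
        by (simp_all add: field_simps)
      show ?thesis unfolding sin_diff_sin e ..
    qed
    with Suc show ?case by (simp add: distrib_left)
  qed simp
  have "(real (N - 1) + 1 / 2) * \<theta> = real a * pi - \<theta> / 2"
    using N by (simp add: \<theta>_def field_simps of_nat_diff)
  then have "sin ((real (N - 1) + 1 / 2) * \<theta>) = - ((-1) ^ a) * sin (\<theta> / 2)"
    by (simp add: sin_diff cos_npi)
  with tele[of "N - 1"] have "2 * sin (\<theta> / 2) * (\<Sum>k<N - 1. cos (real (Suc k) * \<theta>))
      = 2 * sin (\<theta> / 2) * ((- ((-1) ^ a) - 1) / 2)"
    by (simp add: algebra_simps)
  then have "(\<Sum>k<N - 1. cos (real (Suc k) * \<theta>)) = (- ((-1) ^ a) - 1) / 2"
    using s by simp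
  then show ?thesis by (simp add: \<theta>_def mult_ac)
qed

text \<open>Off the diagonal i - j and i + j have the same parity, so the two cosine sums agree and
  cancel. On the diagonal the first sum consists of N - 1 ones and the second equals -1, which gives
  N / 2.\<close>

lemma sum_sin_grid:
  assumes "0 < i" "i < N" "0 < j" "j < N"
  shows "(\<Sum>k<N - 1. sin (real i * real (Suc k) * pi / real N) * sin (real j * real (Suc k) * pi / real N))
    = (if i = j then real N / 2 else 0)"
proof -
  \<comment> \<open>The case j <= i comes first because i - j is a subtraction of natural numbers;
    the other case follows by exchanging the factors.\<close>
  have *: "(\<Sum>k<N - 1. sin (real i * real (Suc k) * pi / real N) * sin (real j * real (Suc k) * pi / real N))
    = (if i = j then real N / 2 else 0)" if "j \<le> i" "0 < i" "i < N" "0 < j" for i j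
  proof -
    have "sin (real i * real (Suc k) * pi / real N) * sin (real j * real (Suc k) * pi / real N)
      = (cos (real (i - j) * real (Suc k) * pi / real N) - cos (real (i + j) * real (Suc k) * pi / real N)) / 2" for k
    proof -
      have "real (i - j) * real (Suc k) * pi / real N
          = real i * real (Suc k) * pi / real N - real j * real (Suc k) * pi / real N"
        by (simp only: of_nat_diff[OF \<open>j \<le> i\<close>] left_diff_distrib diff_divide_distrib)
      moreover have "real (i + j) * real (Suc k) * pi / real N
          = real i * real (Suc k) * pi / real N + real j * real (Suc k) * pi / real N"
        by (simp only: of_nat_add distrib_right add_divide_distrib)
      ultimately show ?thesis by (simp only: sin_times_sin)
    qed
    then have "(\<Sum>k<N - 1. sin (real i * real (Suc k) * pi / real N) * sin (real j * real (Suc k) * pi / real N))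
      = ((\<Sum>k<N - 1. cos (real (i - j) * real (Suc k) * pi / real N))
        - (\<Sum>k<N - 1. cos (real (i + j) * real (Suc k) * pi / real N))) / 2"
      by (simp only: sum_subtractf flip: sum_divide_distrib)
    also have "(\<Sum>k<N - 1. cos (real (i + j) * real (Suc k) * pi / real N)) = (- ((-1) ^ (i + j)) - 1) / 2"
      using that by (intro sum_cos_grid) auto
    finally have eq: "(\<Sum>k<N - 1. sin (real i * real (Suc k) * pi / real N) * sin (real j * real (Suc k) * pi / real N))
      = ((\<Sum>k<N - 1. cos (real (i - j) * real (Suc k) * pi / real N)) - (- ((-1) ^ (i + j)) - 1) / 2) / 2" .
    show ?thesis
    proof (cases "i = j")
      case True
      have 1: "(-1 :: real) ^ (j + j) = 1" by simp
      have "(\<Sum>k<N - 1. cos (real (j - j) * real (Suc k) * pi / real N)) = real (N - 1)" by simp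
      also have "\<dots> = real N - 1" using that by linarith
      finally show ?thesis unfolding True eq[unfolded True] 1 by (simp only:) simp
    next
      case False
      have "i + j = i - j + 2 * j" using that(1) by linarith
      then have "(-1 :: real) ^ (i + j) = (-1) ^ (i - j) * ((-1)\<^sup>2) ^ j"
        by (simp only: power_add power_mult)
      then have "(-1 :: real) ^ (i + j) = (-1) ^ (i - j)" by (simp only: power2_minus power_one mult_1_right)
      moreover have "(\<Sum>k<N - 1. cos (real (i - j) * real (Suc k) * pi / real N)) = (- ((-1) ^ (i - j)) - 1) / 2"
        using that False by (intro sum_cos_grid) auto
      ultimately show ?thesis unfolding eq using False by simp
    qed
  qed
  show ?thesis
  proof (cases "j \<le> i")
    case True
    then show ?thesis using * assms by blast
  next
    case False
    have "(\<Sum>k<N - 1. sin (real i * real (Suc k) * pi / real N) * sin (real j * real (Suc k) * pi / real N))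
      = (\<Sum>k<N - 1. sin (real j * real (Suc k) * pi / real N) * sin (real i * real (Suc k) * pi / real N))"
      by (intro sum.cong refl mult.commute)
    also have "\<dots> = (if j = i then real N / 2 else 0)"
      using False assms by (intro *) auto
    finally show ?thesis using False by simp
  qed
qed

section \<open>A_h as a diagonal form in the discrete sine basis\<close>

lemma Q_mat_carrier: "Q_mat N \<in> carrier_mat (N - 1) (N - 1)"
  by (simp add: Q_mat_def)

lemma Q_mat_orthogonal: "Q_mat N * transpose_mat (Q_mat N) = 1\<^sub>m (N - 1)"
proof (rule eq_matI)
  fix i j assume "i < dim_row (1\<^sub>m (N - 1) :: real mat)" "j < dim_col (1\<^sub>m (N - 1) :: real mat)"
  then have ij: "i < N - 1" "j < N - 1" by auto
  have sq: "sqrt (2 / real N) * a * (sqrt (2 / real N) * b) = 2 / real N * (a * b)" for a b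
  proof -
    have "sqrt (2 / real N) * a * (sqrt (2 / real N) * b)
        = (sqrt (2 / real N) * sqrt (2 / real N)) * (a * b)" by (simp only: mult_ac)
    then show ?thesis by simp
  qed
  have "(Q_mat N * transpose_mat (Q_mat N)) $$ (i, j)
    = (\<Sum>k<N - 1. 2 / real N * (sin (real (Suc i) * real (Suc k) * pi / real N)
        * sin (real (Suc j) * real (Suc k) * pi / real N)))"
  proof -
    have "(Q_mat N * transpose_mat (Q_mat N)) $$ (i, j) = (\<Sum>k<N - 1. Q_mat N $$ (i, k) * Q_mat N $$ (j, k))"
      using ij carrier_matD[OF Q_mat_carrier[of N]] by (simp add: scalar_prod_def atLeast0LessThan)
    also have "\<dots> = (\<Sum>k<N - 1. 2 / real N * (sin (real (Suc i) * real (Suc k) * pi / real N)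
        * sin (real (Suc j) * real (Suc k) * pi / real N)))"
    proof (rule sum.cong)
      fix k assume "k \<in> {..<N - 1}"
      then have e: "Q_mat N $$ (i', k) = sqrt (2 / real N) * sin (real (Suc i') * real (Suc k) * pi / real N)"
        if "i' < N - 1" for i' using that by (simp add: Q_mat_def)
      show "Q_mat N $$ (i, k) * Q_mat N $$ (j, k) = 2 / real N * (sin (real (Suc i) * real (Suc k) * pi / real N)
        * sin (real (Suc j) * real (Suc k) * pi / real N))"
        unfolding e[OF ij(1)] e[OF ij(2)] by (rule sq)
    qed (rule refl)
    finally show ?thesis .
  qed
  also have "\<dots> = 2 / real N * (if Suc i = Suc j then real N / 2 else 0)"
  proof -
    have "0 < Suc i" "Suc i < N" "0 < Suc j" "Suc j < N" using ij by auto
    then show ?thesis by (simp only: sum_sin_grid flip: sum_distrib_left)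
  qed
  finally show "(Q_mat N * transpose_mat (Q_mat N)) $$ (i, j) = 1\<^sub>m (N - 1) $$ (i, j)"
    using ij by (cases "i = j") simp_all
qed (simp_all add: carrier_matD[OF Q_mat_carrier])

lemma A_mat_carrier: "A_mat l s N \<in> carrier_mat (N - 1) (N - 1)"
  using carrier_matD[OF Q_mat_carrier[of N]] by (intro carrier_matI) (simp_all add: A_mat_def)

text \<open>Pairing with y moves the left factor Q across as its transpose. Symmetry,
  semidefiniteness and coercivity of A_h are all read off from the resulting diagonal form.\<close>

lemma inner_h_A_mat:
  assumes "x \<in> carrier_vec (N - 1)" "y \<in> carrier_vec (N - 1)"
  shows "inner_h h (A_mat l s N *\<^sub>v x) y = h * (\<Sum>k<N - 1. eigval_h l N (Suc k) powr s
    * vec_index (transpose_mat (Q_mat N) *\<^sub>v x) k * vec_index (transpose_mat (Q_mat N) *\<^sub>v y) k)"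
proof -
  let ?Q = "Q_mat N"
  let ?m = "N - 1"
  let ?D = "mat ?m ?m (\<lambda>(i, k). if i = k then eigval_h l N (Suc k) powr s else 0)"
  have Q: "?Q \<in> carrier_mat ?m ?m" "transpose_mat ?Q \<in> carrier_mat ?m ?m"
    using Q_mat_carrier by auto
  have D: "?D \<in> carrier_mat ?m ?m" by simp
  have Qx: "transpose_mat ?Q *\<^sub>v x \<in> carrier_vec ?m" "transpose_mat ?Q *\<^sub>v y \<in> carrier_vec ?m"
    using Q assms by auto
  have "A_mat l s N *\<^sub>v x = ?Q *\<^sub>v (?D *\<^sub>v (transpose_mat ?Q *\<^sub>v x))"
    unfolding A_mat_def
    using assoc_mult_mat_vec[OF mult_carrier_mat[OF Q(1) D] Q(2) assms(1)]
      assoc_mult_mat_vec[OF Q(1) D Qx(1)] by (simp only:)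
  moreover have "scalar_prod (A_mat l s N *\<^sub>v x) y = scalar_prod y (A_mat l s N *\<^sub>v x)"
    by (rule comm_scalar_prod[OF mult_mat_vec_carrier[OF A_mat_carrier assms(1)] assms(2)])
  ultimately have "scalar_prod (A_mat l s N *\<^sub>v x) y = scalar_prod y (?Q *\<^sub>v (?D *\<^sub>v (transpose_mat ?Q *\<^sub>v x)))"
    by (rule subst)
  also have "\<dots> = scalar_prod (transpose_mat ?Q *\<^sub>v y) (?D *\<^sub>v (transpose_mat ?Q *\<^sub>v x))"
    by (rule transpose_vec_mult_scalar[OF Q(1) mult_mat_vec_carrier[OF D Qx(1)] assms(2), symmetric])
  also have "\<dots> = (\<Sum>k<?m. vec_index (transpose_mat ?Q *\<^sub>v y) k * vec_index (?D *\<^sub>v (transpose_mat ?Q *\<^sub>v x)) k)"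
    by (simp only: scalar_prod_def dim_mult_mat_vec dim_row_mat atLeast0LessThan)
  also have "\<dots> = (\<Sum>k<?m. eigval_h l N (Suc k) powr s
    * vec_index (transpose_mat ?Q *\<^sub>v x) k * vec_index (transpose_mat ?Q *\<^sub>v y) k)"
  proof (rule sum.cong)
    fix k assume "k \<in> {..<?m}"
    then have k: "k < ?m" by simp
    have "vec_index (?D *\<^sub>v v) k = eigval_h l N (Suc k) powr s * vec_index v k"
      if "v \<in> carrier_vec ?m" for v
    proof -
      have "vec_index (?D *\<^sub>v v) k = (\<Sum>i\<in>{0..<?m}. (if k = i then eigval_h l N (Suc i) powr s else 0) * vec_index v i)"
        using k that by (simp add: scalar_prod_def)
      also have "\<dots> = (\<Sum>i\<in>{0..<?m}. if k = i then eigval_h l N (Suc i) powr s * vec_index v i else 0)"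
        by (intro sum.cong) auto
      finally show ?thesis using k by simp
    qed
    from this[OF Qx(1)] show "vec_index (transpose_mat ?Q *\<^sub>v y) k * vec_index (?D *\<^sub>v (transpose_mat ?Q *\<^sub>v x)) k
      = eigval_h l N (Suc k) powr s * vec_index (transpose_mat ?Q *\<^sub>v x) k * vec_index (transpose_mat ?Q *\<^sub>v y) k"
      by (simp only: mult_ac)
  qed simp
  finally show ?thesis by (simp only: inner_h_def)
qed

text \<open>Parseval's identity for the discrete sine transform.\<close>

lemma inner_h_transpose_Q_mat:
  assumes "x \<in> carrier_vec (N - 1)"
  shows "inner_h h (transpose_mat (Q_mat N) *\<^sub>v x) (transpose_mat (Q_mat N) *\<^sub>v x) = inner_h h x x"
proof -
  have "scalar_prod (transpose_mat (Q_mat N) *\<^sub>v x) (transpose_mat (Q_mat N) *\<^sub>v x)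
      = scalar_prod x (Q_mat N *\<^sub>v (transpose_mat (Q_mat N) *\<^sub>v x))"
    using assms Q_mat_carrier[of N]
    by (intro transpose_vec_mult_scalar[of _ "N - 1" "N - 1"] mult_mat_vec_carrier[of _ "N - 1" "N - 1"]) auto
  also have "Q_mat N *\<^sub>v (transpose_mat (Q_mat N) *\<^sub>v x) = x"
    using assoc_mult_mat_vec[OF Q_mat_carrier[of N] transpose_carrier_mat[THEN iffD2, OF Q_mat_carrier[of N]] assms]
      one_mult_mat_vec[OF assms] by (simp only: Q_mat_orthogonal)
  finally show ?thesis by (simp only: inner_h_def)
qed

section \<open>A lower bound for A_h that is uniform in the mesh\<close>

lemma abs_sin_mult_le: "\<bar>sin (real n * x)\<bar> \<le> real n * \<bar>sin x\<bar>"
proof (induction n)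
  case (Suc n)
  have "\<bar>sin (real (Suc n) * x)\<bar> \<le> \<bar>sin (real n * x)\<bar> * \<bar>cos x\<bar> + \<bar>cos (real n * x)\<bar> * \<bar>sin x\<bar>"
  proof -
    have "sin (real (Suc n) * x) = sin (real n * x) * cos x + cos (real n * x) * sin x"
      using sin_add[of "real n * x" x] by (simp add: algebra_simps)
    then show ?thesis
      using abs_triangle_ineq[of "sin (real n * x) * cos x" "cos (real n * x) * sin x"]
      by (simp only: abs_mult)
  qed
  also have "\<dots> \<le> \<bar>sin (real n * x)\<bar> * 1 + 1 * \<bar>sin x\<bar>"
    by (intro add_mono mult_mono) auto
  finally show ?case using Suc by (simp add: distrib_right)
qed simp

text \<open>The sine increases on [0, pi/2], so the lowest mode is the smallest. Since h = l / N,
  its eigenvalue is 4 / l^2 times (N sin (pi / (2 N)))^2, and it remains to see that this square is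
  at least 1 for every N.\<close>

lemma eigval_h_ge:
  assumes "0 < l" "k < N - 1"
  shows "4 / l\<^sup>2 \<le> eigval_h l N (Suc k)"
proof -
  have N: "0 < N" using assms by simp
  define x where "x = pi / (2 * real N)"
  have x: "0 < x" "x \<le> pi / 2" using N by (auto simp: x_def field_simps)
  have "real (Suc k) * x \<le> real N * x" using assms x by (intro mult_right_mono) auto
  moreover have Nx: "real N * x = pi / 2" using N by (simp add: x_def)
  moreover have "1 * x \<le> real (Suc k) * x" using x by (intro mult_right_mono) auto
  ultimately have "sin x \<le> sin (real (Suc k) * x)"
    using x by (intro sin_monotone_2pi_le) auto
  \<comment> \<open>\<open>abs_sin_mult_le\<close> with n = N: here N x = pi / 2, so its left side
    is 1.\<close>
  moreover have "1 \<le> real N * sin x"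
    using abs_sin_mult_le[of N x] sin_ge_zero[of x] x by (simp add: Nx)
  ultimately have "1 \<le> real N * sin (real (Suc k) * x)"
    by (meson mult_left_mono of_nat_0_le_iff order_trans)
  then have "1 \<le> (real N * sin (real (Suc k) * x))\<^sup>2" by (simp add: power2_nonneg_ge_1_iff)
  then have "4 / l\<^sup>2 * 1 \<le> 4 / l\<^sup>2 * (real N * sin (real (Suc k) * x))\<^sup>2"
    by (intro mult_left_mono) auto
  also have "\<dots> = eigval_h l N (Suc k)"
    using N by (simp add: eigval_h_def x_def power_divide power_mult_distrib)
  finally show ?thesis by simp
qed

text \<open>Coercivity in the sine coefficients, followed by Cauchy-Schwarz and division by the norm
  of x. Its purpose is to turn the bound on the image of the weight under A_h into a bound on the
  weight itself.\<close>

lemma norm_h_A_mat_ge: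
  assumes "0 < l" "0 \<le> s" "0 < h" "x \<in> carrier_vec (N - 1)"
  shows "(4 / l\<^sup>2) powr s * norm_h h x \<le> norm_h h (A_mat l s N *\<^sub>v x)"
proof -
  let ?q = "transpose_mat (Q_mat N) *\<^sub>v x"
  have q: "?q \<in> carrier_vec (N - 1)" using assms Q_mat_carrier[of N] by auto
  have "(4 / l\<^sup>2) powr s * inner_h h x x = h * (\<Sum>k<N - 1. (4 / l\<^sup>2) powr s * (vec_index ?q k)\<^sup>2)"
  proof -
    have "inner_h h x x = h * (\<Sum>k<N - 1. (vec_index ?q k)\<^sup>2)"
      using inner_h_transpose_Q_mat[OF assms(4), of h]
      by (simp only: inner_h_def scalar_prod_def carrier_vecD[OF q] power2_eq_square atLeast0LessThan)
    then show ?thesis by (simp add: sum_distrib_left[symmetric] del: index_mult_mat_vec)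
  qed
  also have "\<dots> \<le> h * (\<Sum>k<N - 1. eigval_h l N (Suc k) powr s * (vec_index ?q k)\<^sup>2)"
    using assms by (intro mult_left_mono sum_mono mult_right_mono powr_mono2 eigval_h_ge) auto
  also have "\<dots> = inner_h h (A_mat l s N *\<^sub>v x) x"
    by (simp add: inner_h_A_mat[OF assms(4,4)] power2_eq_square mult.assoc del: index_mult_mat_vec)
  also have "\<dots> \<le> norm_h h (A_mat l s N *\<^sub>v x) * norm_h h x"
  proof -
    have "A_mat l s N *\<^sub>v x \<in> carrier_vec (N - 1)" using A_mat_carrier[of l s N] assms by auto
    then show ?thesis using inner_h_Cauchy_Schwarz[of h _ "N - 1" x] assms by (simp add: abs_le_iff)
  qed
  finally have "((4 / l\<^sup>2) powr s * norm_h h x) * norm_h h x \<le> norm_h h (A_mat l s N *\<^sub>v x) * norm_h h x"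
    using assms by (simp add: inner_h_self power2_eq_square mult.assoc)
  then show ?thesis
    using norm_h_nonneg[of h x] norm_h_nonneg[of h "A_mat l s N *\<^sub>v x"] assms(3)
    by (cases "norm_h h x = 0") auto
qed

lemma crank_nicolson_A_mat:
  assumes "0 < h" "0 < \<tau>"
  shows "crank_nicolson (N - 1) h \<tau> (A_mat l s N)"
proof
  show "A_mat l s N \<in> carrier_mat (N - 1) (N - 1)" by (rule A_mat_carrier)
  fix x y :: "real vec" assume xy: "x \<in> carrier_vec (N - 1)" "y \<in> carrier_vec (N - 1)"
  have "A_mat l s N *\<^sub>v y \<in> carrier_vec (N - 1)" using A_mat_carrier[of l s N] xy by auto
  then show "inner_h h (A_mat l s N *\<^sub>v x) y = inner_h h x (A_mat l s N *\<^sub>v y)"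
    unfolding inner_h_commute[OF xy(1) \<open>A_mat l s N *\<^sub>v y \<in> _\<close>] inner_h_A_mat[OF xy]
      inner_h_A_mat[OF xy(2,1)]
    by (simp only: mult_ac)
next
  fix x :: "real vec" assume "x \<in> carrier_vec (N - 1)"
  then show "0 \<le> inner_h h (A_mat l s N *\<^sub>v x) x"
    unfolding inner_h_A_mat[OF \<open>x \<in> _\<close> \<open>x \<in> _\<close>] mult.assoc using assms(1)

    by (intro mult_nonneg_nonneg[OF _ sum_nonneg] mult_nonneg_nonneg[OF powr_ge_zero zero_le_square]) auto
qed (use assms in auto)

section \<open>Truncation error\<close>

lemma grid_vec_carrier [simp]: "grid_vec l N v \<in> carrier_vec (N - 1)"
  by (simp add: grid_vec_def)

lemmas grid_vec_carrier_Suc [simp] = grid_vec_carrier[unfolded One_nat_def]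

lemma index_grid_vec: "i < N - 1 \<Longrightarrow> vec_index (grid_vec l N v) i = v (real (Suc i) * (l / real N))"
  by (simp add: grid_vec_def)

lemma grid_point_in_interval:
  assumes "0 < l" "i < N - 1"
  shows "real (Suc i) * (l / real N) \<in> {0<..<l}"
proof -
  have "real (Suc i) < real N" using assms by linarith
  then have "real (Suc i) * l < real N * l" using assms by simp
  then show ?thesis using assms by (simp add: divide_less_eq mult.commute del: of_nat_Suc)
qed

lemma grid_vec_cong:
  assumes "0 < l" "\<And>x. x \<in> {0<..<l} \<Longrightarrow> v x = w x"
  shows "grid_vec l N v = grid_vec l N w"
proof (rule eq_vecI)
  fix i assume "i < dim_vec (grid_vec l N w)"
  then have i: "i < N - 1" by (simp add: grid_vec_def)
  show "vec_index (grid_vec l N v) i = vec_index (grid_vec l N w) i"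
    unfolding index_grid_vec[OF i] by (rule assms(2)[OF grid_point_in_interval[OF assms(1) i]])
qed (simp add: grid_vec_def)

lemma inner_h_grid_vec:
  "c \<in> carrier_vec (N - 1) \<Longrightarrow>
    inner_h h (grid_vec l N v) c = (\<Sum>j<N - 1. h * vec_index c j * v (real (Suc j) * (l / real N)))"
  by (simp add: inner_h_def scalar_prod_def grid_vec_def sum_distrib_left atLeast0LessThan mult_ac)

lemma Ck_on_has_derivative:
  assumes "0 < T" "Ck_on k T g" "j < k" "t \<in> {0..T}"
  shows "((ivl_deriv T ^^ j) g has_real_derivative (ivl_deriv T ^^ Suc j) g t) (at t within {0..T})"
proof -
  have "(ivl_deriv T ^^ j) g differentiable (at t within {0..T})"
    using assms by (auto simp: Ck_on_def)
  then show ?thesis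
    by (simp add: has_real_derivative_iff_has_vector_derivative ivl_deriv_def vector_derivative_works)
qed

text \<open>Pairing with a fixed vector reduces this to the scalar Taylor formula; no integral of a
  norm is needed.\<close>

lemma grid_Taylor:
  fixes g :: "nat \<Rightarrow> real \<Rightarrow> real \<Rightarrow> real"
  assumes l: "0 < l" and h: "0 \<le> h" and S: "convex S"
    and deriv: "\<And>i x t. x \<in> {0<..<l} \<Longrightarrow> t \<in> S \<Longrightarrow> i \<le> n \<Longrightarrow>
      (g i x has_real_derivative g (Suc i) x t) (at t within S)"
    and bound: "\<And>t. t \<in> S \<Longrightarrow> norm_h h (grid_vec l N (\<lambda>x. g (Suc n) x t)) \<le> K"
    and w: "w \<in> S" and z: "z \<in> S"
  shows "norm_h h (grid_vec l N (\<lambda>x. g 0 x z - (\<Sum>i\<le>n. g i x w * (z - w) ^ i / fact i)))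
    \<le> K * \<bar>z - w\<bar> ^ Suc n / fact n"
proof (rule norm_h_le_dual[OF h _ grid_vec_carrier])
  have K: "0 \<le> K" using bound[OF w] norm_h_nonneg[OF h] by (rule order_trans[rotated])
  then show "0 \<le> K * \<bar>z - w\<bar> ^ Suc n / fact n" by simp
  fix c :: "real vec" assume c: "c \<in> carrier_vec (N - 1)"
  define X where "X j = real (Suc j) * (l / real N)" for j
  \<comment> \<open>The pairing of the i-th derivative with c: a finite sum of scalar functions,
    differentiated term by term, whose last member Cauchy-Schwarz bounds by K times the norm of
    c.\<close>
  define G where "G i t = (\<Sum>j<N - 1. h * vec_index c j * g i (X j) t)" for i t
  have G: "G i t = inner_h h (grid_vec l N (\<lambda>x. g i x t)) c" for i t
    using c by (simp only: inner_h_grid_vec G_def X_def)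
  have "norm (G 0 z - (\<Sum>i\<le>n. G i w * (z - w) ^ i / fact i))
      \<le> (K * norm_h h c) * norm (z - w) ^ Suc n / fact n"
  proof (rule field_Taylor[OF S _ _ w z])
    fix i t assume t: "t \<in> S" and i: "i \<le> n"
    show "(G i has_field_derivative G (Suc i) t) (at t within S)"
      unfolding G_def
    proof (rule DERIV_sum, rule DERIV_cmult)
      fix j assume "j \<in> {..<N - 1}"
      then have "X j \<in> {0<..<l}" unfolding X_def by (intro grid_point_in_interval l) simp
      then show "(g i (X j) has_real_derivative g (Suc i) (X j) t) (at t within S)"
        using t i by (rule deriv)
    qed
  next
    fix t assume t: "t \<in> S"
    have "\<bar>G (Suc n) t\<bar> \<le> norm_h h (grid_vec l N (\<lambda>x. g (Suc n) x t)) * norm_h h c"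
      unfolding G by (rule inner_h_Cauchy_Schwarz[OF h grid_vec_carrier c])
    also have "\<dots> \<le> K * norm_h h c"
      using bound[OF t] norm_h_nonneg[OF h] by (rule mult_right_mono)
    finally show "norm (G (Suc n) t) \<le> K * norm_h h c" by simp
  qed
  moreover have "inner_h h (grid_vec l N (\<lambda>x. g 0 x z - (\<Sum>i\<le>n. g i x w * (z - w) ^ i / fact i))) c
      = G 0 z - (\<Sum>i\<le>n. G i w * (z - w) ^ i / fact i)"
  proof -
    have "(\<Sum>j<N - 1. h * vec_index c j * (\<Sum>i\<le>n. g i (X j) w * (z - w) ^ i / fact i))
        = (\<Sum>j<N - 1. \<Sum>i\<le>n. h * vec_index c j * g i (X j) w * (z - w) ^ i / fact i)"
      by (simp only: sum_distrib_left mult.assoc times_divide_eq_right)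
    also have "\<dots> = (\<Sum>i\<le>n. \<Sum>j<N - 1. h * vec_index c j * g i (X j) w * (z - w) ^ i / fact i)"
      by (rule sum.swap)
    also have "\<dots> = (\<Sum>i\<le>n. G i w * (z - w) ^ i / fact i)"
      by (simp only: G_def sum_distrib_right sum_divide_distrib)
    finally show ?thesis
      using c by (simp only: inner_h_grid_vec right_diff_distrib sum_subtractf G_def flip: X_def)
  qed
  ultimately show "\<bar>inner_h h (grid_vec l N (\<lambda>x. g 0 x z - (\<Sum>i\<le>n. g i x w * (z - w) ^ i / fact i))) c\<bar>
      \<le> K * \<bar>z - w\<bar> ^ Suc n / fact n * norm_h h c"
    by (simp add: mult_ac)
qed

text \<open>The induction carries the crude bound (1 + \<tau> K)^n n \<tau> B instead of a geometric
  sum. Nothing is divided by K, so K = 0 is covered, and n \<tau> <= T makes the result independent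
  of M.\<close>

lemma discrete_Gronwall:
  fixes e :: "nat \<Rightarrow> real"
  assumes "0 \<le> \<tau>" "0 \<le> K" "0 \<le> B" "e 0 = 0"
    and step: "\<And>n. n < M \<Longrightarrow> e (Suc n) \<le> (1 + \<tau> * K) * e n + \<tau> * B"
    and M: "real M * \<tau> \<le> T" and n: "n \<le> M"
  shows "e n \<le> T * exp (K * T) * B"
proof -
  have 1: "e n \<le> (1 + \<tau> * K) ^ n * (real n * \<tau> * B)" if "n \<le> M" for n
    using that
  proof (induction n)
    case 0
    then show ?case using assms by simp
  next
    case (Suc n)
    have ge: "1 \<le> (1 + \<tau> * K) ^ Suc n" using assms by (intro one_le_power) simp
    have "e (Suc n) \<le> (1 + \<tau> * K) * e n + \<tau> * B" using Suc by (intro step) simp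
    also have "\<dots> \<le> (1 + \<tau> * K) * ((1 + \<tau> * K) ^ n * (real n * \<tau> * B)) + (1 + \<tau> * K) ^ Suc n * (\<tau> * B)"
    proof (rule add_mono)
      show "(1 + \<tau> * K) * e n \<le> (1 + \<tau> * K) * ((1 + \<tau> * K) ^ n * (real n * \<tau> * B))"
        using Suc assms by (intro mult_left_mono) auto
      show "\<tau> * B \<le> (1 + \<tau> * K) ^ Suc n * (\<tau> * B)"
        using mult_right_mono[OF ge, of "\<tau> * B"] assms by simp
    qed
    also have "\<dots> = (1 + \<tau> * K) ^ Suc n * (real (Suc n) * \<tau> * B)" by (simp add: algebra_simps)
    finally show ?case .
  qed
  have nT: "real n * \<tau> \<le> T"
    using mult_right_mono[of "real n" "real M" \<tau>] n M assms by simp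
  then have T: "0 \<le> T" using assms by (meson mult_nonneg_nonneg of_nat_0_le_iff order_trans)
  have "(1 + \<tau> * K) ^ n \<le> exp (\<tau> * K) ^ n"
    using assms by (intro power_mono) (auto simp: exp_ge_add_one_self)
  also have "\<dots> = exp (K * (real n * \<tau>))" by (simp add: mult_ac flip: exp_of_nat_mult)
  also have "\<dots> \<le> exp (K * T)" using nT assms by (simp add: mult_left_mono)
  finally have "(1 + \<tau> * K) ^ n * (real n * \<tau> * B) \<le> exp (K * T) * (T * B)"
    using nT T assms by (intro mult_mono) (auto intro: mult_right_mono)
  with 1[OF n] show ?thesis by (simp add: mult_ac)
qed

text \<open>The residual consists of the error of the difference quotient, the error of averaging
  \<open>Lu\<close> over the two ends of the step, and the spatial consistency error. The first is
  stated separately because it also enters the comparison of z with the tested difference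
  quotient.\<close>

lemma Crank_Nicolson_truncation:
  fixes l T \<tau> h a b r_b :: real and u f Lu :: "real \<Rightarrow> real \<Rightarrow> real" and r :: "real \<Rightarrow> real"
  assumes l: "0 < l" and T: "0 < T" and h: "0 \<le> h" and \<tau>: "0 < \<tau>" and a: "0 \<le> a" "a + \<tau> \<le> T"
    and b: "b = a + \<tau> / 2" and A: "A \<in> carrier_mat (N - 1) (N - 1)"
    and eqn: "\<And>t x. t \<in> {0..T} \<Longrightarrow> x \<in> {0<..<l} \<Longrightarrow>
      ivl_deriv T (\<lambda>t'. u t' x) t + Lu t x = r t * f t x"
    and Cu: "\<And>x. x \<in> {0<..<l} \<Longrightarrow> Ck_on 3 T (\<lambda>t. u t x)"
    and Crf: "\<And>x. x \<in> {0<..<l} \<Longrightarrow> Ck_on 2 T (\<lambda>t. r t * f t x)"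
    and bound: "\<And>t. t \<in> {0..T} \<Longrightarrow>
      norm_h h (grid_vec l N (\<lambda>x. (ivl_deriv T ^^ 3) (\<lambda>t'. u t' x) t))
      + norm_h h (grid_vec l N (\<lambda>x. (ivl_deriv T ^^ 2) (\<lambda>t'. r t' * f t' x) t)) \<le> K"
    and cons: "\<And>t. t \<in> {0..T} \<Longrightarrow> norm_h h (A *\<^sub>v grid_vec l N (u t) - grid_vec l N (Lu t)) \<le> E"
  shows "norm_h h ((1 / \<tau>) \<cdot>\<^sub>v (grid_vec l N (u (a + \<tau>)) - grid_vec l N (u a))
      - grid_vec l N (\<lambda>x. ivl_deriv T (\<lambda>t'. u t' x) b)) \<le> K * \<tau>\<^sup>2 / 8" (is "norm_h h ?\<alpha> \<le> _")
    and "norm_h h ((1 / \<tau>) \<cdot>\<^sub>v (grid_vec l N (u (a + \<tau>)) - grid_vec l N (u a))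
      + (1 / 2) \<cdot>\<^sub>v (A *\<^sub>v grid_vec l N (u (a + \<tau>)) + A *\<^sub>v grid_vec l N (u a))
      - r b \<cdot>\<^sub>v grid_vec l N (f b)) \<le> K * \<tau>\<^sup>2 + E" (is "norm_h h ?\<rho> \<le> _")
proof -
  let ?D = "\<lambda>i x. (ivl_deriv T ^^ i) (\<lambda>t'. u t' x)"
  let ?F = "\<lambda>i x. (ivl_deriv T ^^ i) (\<lambda>t'. r t' * f t' x)"
  let ?g = "grid_vec l N"
  have t: "a \<in> {0..T}" "b \<in> {0..T}" "a + \<tau> \<in> {0..T}" using a b \<tau> by auto
  have K: "0 \<le> K" using bound[OF t(1)] norm_h_nonneg[OF h] by (smt (verit))
  have half: "\<bar>a + \<tau> - b\<bar> = \<tau> / 2" "\<bar>a - b\<bar> = \<tau> / 2" using b \<tau> by auto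
  have tri: "norm_h h (?g p + ?g q) \<le> norm_h h (?g p) + norm_h h (?g q)"
    and tri': "norm_h h (?g p - ?g q) \<le> norm_h h (?g p) + norm_h h (?g q)" for p q
    using norm_h_triangle[OF h grid_vec_carrier grid_vec_carrier]
      norm_h_triangle_minus[OF h grid_vec_carrier grid_vec_carrier] by blast+
  \<comment> \<open>The second order Taylor remainder about the midpoint b. In the difference over
    the two ends the constant and quadratic terms cancel; each remainder is at most K (\<tau>/2)^3 /
    2, which after division by \<tau> gives K \<tau>^2 / 8.\<close>
  define R where "R z x = ?D 0 x z - (\<Sum>i\<le>2. ?D i x b * (z - b) ^ i / fact i)" for z x
  have R: "norm_h h (?g (R z)) \<le> K * \<bar>z - b\<bar> ^ 3 / 2" if "z \<in> {0..T}" for z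
  proof -
    have "norm_h h (?g (R z)) \<le> K * \<bar>z - b\<bar> ^ Suc 2 / fact 2"
      unfolding R_def
    proof (rule grid_Taylor[OF l h _ _ _ t(2) that])
      fix i :: nat and x t :: real assume "x \<in> {0<..<l}" "t \<in> {0..T}" "i \<le> 2"
      then show "(?D i x has_real_derivative ?D (Suc i) x t) (at t within {0..T})"
        by (intro Ck_on_has_derivative[OF T Cu]) auto
    next
      fix t assume "t \<in> {0..T}"
      then have "norm_h h (?g (\<lambda>x. ?D 3 x t)) \<le> K"
        using bound[of t] norm_h_nonneg[OF h, of "?g (\<lambda>x. ?F 2 x t)"] by linarith
      moreover have "Suc 2 = (3 :: nat)" by simp
      ultimately show "norm_h h (?g (\<lambda>x. ?D (Suc 2) x t)) \<le> K" by (simp only:)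
    qed simp
    then show ?thesis by (simp add: numeral_3_eq_3 numeral_2_eq_2)
  qed
  have "?\<alpha> = (1 / \<tau>) \<cdot>\<^sub>v (?g (R (a + \<tau>)) - ?g (R a))"
  proof (rule eq_vecI)
    fix i assume "i < dim_vec ((1 / \<tau>) \<cdot>\<^sub>v (?g (R (a + \<tau>)) - ?g (R a)))"
    then have i: "i < N - 1" by (simp add: grid_vec_def)
    have "R (a + \<tau>) x - R a x = u (a + \<tau>) x - u a x - \<tau> * ivl_deriv T (\<lambda>t'. u t' x) b" for x
      unfolding R_def b by (simp add: numeral_2_eq_2 field_simps)
    then show "vec_index ?\<alpha> i = vec_index ((1 / \<tau>) \<cdot>\<^sub>v (?g (R (a + \<tau>)) - ?g (R a))) i"
      using i \<tau> by (simp add: grid_vec_def field_simps del: of_nat_Suc)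
  qed (simp add: grid_vec_def)
  then have "norm_h h ?\<alpha> = 1 / \<tau> * norm_h h (?g (R (a + \<tau>)) - ?g (R a))"
    using \<tau> by (simp add: norm_h_smult)
  also have "\<dots> \<le> 1 / \<tau> * (K * \<bar>a + \<tau> - b\<bar> ^ 3 / 2 + K * \<bar>a - b\<bar> ^ 3 / 2)"
    using \<tau> tri'[of "R (a + \<tau>)" "R a"]
      R[OF t(1)] R[OF t(3)] by (intro mult_left_mono) (linarith, simp)
  also have "\<dots> = K * \<tau>\<^sup>2 / 8"
    unfolding half using \<tau> by (simp add: power2_eq_square power3_eq_cube)
  finally show \<alpha>: "norm_h h ?\<alpha> \<le> K * \<tau>\<^sup>2 / 8" .

  \<comment> \<open>The first order remainder of \<open>Lu\<close>, written as r f - u_t; its second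
    derivative (rf)_tt - u_ttt is what the assumed sum of norms bounds. In the sum over the two ends
    the linear terms cancel.\<close>
  define R2 where "R2 z x = (?F 0 x z - ?D 1 x z) - (\<Sum>i\<le>1. (?F i x b - ?D (Suc i) x b) * (z - b) ^ i / fact i)"
    for z x
  have R2: "norm_h h (?g (R2 z)) \<le> K * \<bar>z - b\<bar>\<^sup>2" if "z \<in> {0..T}" for z
  proof -
    have "norm_h h (?g (\<lambda>x. (?F 0 x z - ?D (Suc 0) x z)
        - (\<Sum>i\<le>1. (?F i x b - ?D (Suc i) x b) * (z - b) ^ i / fact i))) \<le> K * \<bar>z - b\<bar> ^ Suc 1 / fact 1"
    proof (rule grid_Taylor[OF l h _ _ _ t(2) that, where g = "\<lambda>i x t. ?F i x t - ?D (Suc i) x t"])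
      fix i :: nat and x t :: real assume "x \<in> {0<..<l}" "t \<in> {0..T}" "i \<le> 1"
      then show "((\<lambda>t. ?F i x t - ?D (Suc i) x t) has_real_derivative ?F (Suc i) x t - ?D (Suc (Suc i)) x t)
          (at t within {0..T})"
        by (intro DERIV_diff Ck_on_has_derivative[OF T Cu] Ck_on_has_derivative[OF T Crf]) auto
    next
      fix t assume t: "t \<in> {0..T}"
      have eq: "?g (\<lambda>x. ?F (Suc 1) x t - ?D (Suc (Suc 1)) x t) = ?g (\<lambda>x. ?F 2 x t) - ?g (\<lambda>x. ?D 3 x t)"
        by (intro eq_vecI) (simp_all add: grid_vec_def numeral_2_eq_2 numeral_3_eq_3)
      show "norm_h h (?g (\<lambda>x. ?F (Suc 1) x t - ?D (Suc (Suc 1)) x t)) \<le> K"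
        unfolding eq using bound[OF t] tri'[of "\<lambda>x. ?F 2 x t" "\<lambda>x. ?D 3 x t"] by linarith
    qed simp
    then show ?thesis unfolding R2_def by (simp add: power2_eq_square)
  qed
  define \<beta> where "\<beta> = (1 / 2) \<cdot>\<^sub>v (?g (R2 (a + \<tau>)) + ?g (R2 a))"
  define \<gamma> where "\<gamma> = (1 / 2) \<cdot>\<^sub>v ((A *\<^sub>v ?g (u (a + \<tau>)) - ?g (Lu (a + \<tau>))) + (A *\<^sub>v ?g (u a) - ?g (Lu a)))"
  have carr: "?\<alpha> \<in> carrier_vec (N - 1)" "\<beta> \<in> carrier_vec (N - 1)" "\<gamma> \<in> carrier_vec (N - 1)"
    "A *\<^sub>v ?g (u (a + \<tau>)) - ?g (Lu (a + \<tau>)) \<in> carrier_vec (N - 1)"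
    "A *\<^sub>v ?g (u a) - ?g (Lu a) \<in> carrier_vec (N - 1)"
    using A by (auto simp: \<beta>_def \<gamma>_def)
  have "norm_h h (?g (R2 (a + \<tau>)) + ?g (R2 a)) \<le> K * \<bar>a + \<tau> - b\<bar>\<^sup>2 + K * \<bar>a - b\<bar>\<^sup>2"
    using tri[of "R2 (a + \<tau>)" "R2 a"]
      R2[OF t(1)] R2[OF t(3)] by linarith
  also have "\<dots> = K * \<tau>\<^sup>2 / 2" unfolding half by (simp add: power_divide)
  finally have \<beta>: "norm_h h \<beta> \<le> K * \<tau>\<^sup>2 / 4" unfolding \<beta>_def norm_h_smult by simp
  have \<gamma>: "norm_h h \<gamma> \<le> E"
    using norm_h_triangle[OF h carr(4,5)] cons[OF t(1)] cons[OF t(3)] unfolding \<gamma>_def norm_h_smult by simp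
  \<comment> \<open>The equation at b replaces r f by u_t + \<open>Lu\<close>: u_t completes
    \<alpha>, \<open>Lu\<close> at b completes the average in \<beta>, and \<gamma> exchanges A u
    for \<open>Lu\<close> at both ends.\<close>
  have "?\<rho> = ?\<alpha> + (\<beta> + \<gamma>)"
  proof (rule eq_vecI)
    show "dim_vec ?\<rho> = dim_vec (?\<alpha> + (\<beta> + \<gamma>))" using carr by (simp add: grid_vec_def)
    fix i assume "i < dim_vec (?\<alpha> + (\<beta> + \<gamma>))"
    then have i: "i < N - 1" using carr by simp
    define x where "x = real (Suc i) * (l / real N)"
    have x: "x \<in> {0<..<l}" unfolding x_def by (rule grid_point_in_interval[OF l i])
    have R2x: "R2 z x = Lu z x - Lu b x - (?F 1 x b - ?D 2 x b) * (z - b)" if "z \<in> {0..T}" for z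
      using eqn[OF that x] eqn[OF t(2) x] unfolding R2_def by (simp add: numeral_2_eq_2 algebra_simps)
    have sum: "R2 (a + \<tau>) x + R2 a x = Lu (a + \<tau>) x + Lu a x - 2 * Lu b x"
      unfolding R2x[OF t(1)] R2x[OF t(3)] by (simp add: b algebra_simps)
    obtain p q where pq: "vec_index (A *\<^sub>v ?g (u (a + \<tau>))) i = p" "vec_index (A *\<^sub>v ?g (u a)) i = q" by blast
    have dimA: "dim_row A = N - 1" using A by simp
    have "vec_index ?\<rho> i = (1 / \<tau>) * (u (a + \<tau>) x - u a x) + (1 / 2) * (p + q) - r b * f b x"
      using i dimA pq by (simp add: grid_vec_def x_def del: index_mult_mat_vec of_nat_Suc)
    also have "r b * f b x = ivl_deriv T (\<lambda>t'. u t' x) b + Lu b x" using eqn[OF t(2) x] by simp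
    also have "(1 / \<tau>) * (u (a + \<tau>) x - u a x) + (1 / 2) * (p + q) - (ivl_deriv T (\<lambda>t'. u t' x) b + Lu b x)
        = ((1 / \<tau>) * (u (a + \<tau>) x - u a x) - ivl_deriv T (\<lambda>t'. u t' x) b)
          + ((1 / 2) * (R2 (a + \<tau>) x + R2 a x) + (1 / 2) * ((p - Lu (a + \<tau>) x) + (q - Lu a x)))"
      unfolding sum by (simp add: field_simps)
    also have "\<dots> = vec_index (?\<alpha> + (\<beta> + \<gamma>)) i"
      using i dimA pq unfolding \<beta>_def \<gamma>_def
      by (simp add: grid_vec_def x_def del: index_mult_mat_vec of_nat_Suc)
    finally show "vec_index ?\<rho> i = vec_index (?\<alpha> + (\<beta> + \<gamma>)) i" .
  qed
  then have "norm_h h ?\<rho> \<le> norm_h h ?\<alpha> + (norm_h h \<beta> + norm_h h \<gamma>)"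
    using norm_h_triangle[OF h carr(1), of "\<beta> + \<gamma>"] norm_h_triangle[OF h carr(2,3)] carr by simp
  \<comment> \<open>The coefficient 1/8 + 1/4 is rounded up to 1.\<close>
  with \<alpha> \<beta> \<gamma> show "norm_h h ?\<rho> \<le> K * \<tau>\<^sup>2 + E"
    using K mult_nonneg_nonneg[OF K zero_le_power2[of \<tau>]] by linarith
qed

section \<open>Convergence\<close>

theorem theorem4p10:
  fixes l T s :: real
    and f u Lu :: "real \<Rightarrow> real \<Rightarrow> real"
    and \<phi> \<omega> w r :: "real \<Rightarrow> real"
    and Ct Cv \<kappa>0 CQ C\<omega> CF :: real
  assumes "l > 0" and "T > 0" and "0 < s" and "s < 1"
    and "\<omega> \<in> L2_on l" and "\<And>t. t \<in> {0..T} \<Longrightarrow> f t \<in> L2_on l"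
    and "exact_solution l T f \<phi> \<omega> w u Lu r"
    and "sufficiently_regular l T s f u Lu r"
    and h1: "\<And>N t. 2 \<le> N \<Longrightarrow> t \<in> {0..T} \<Longrightarrow>
       norm_h (l / real N) (grid_vec l N (\<lambda>x. (ivl_deriv T ^^ 3) (\<lambda>t'. u t' x) t))
       + norm_h (l / real N) (grid_vec l N (\<lambda>x. (ivl_deriv T ^^ 2) (\<lambda>t'. r t' * f t' x) t)) \<le> Ct"
    and h2: "\<And>N t. 2 \<le> N \<Longrightarrow> t \<in> {0..T} \<Longrightarrow>
       norm_h (l / real N) (A_mat l s N *\<^sub>v grid_vec l N (u t) - grid_vec l N (Lu t))
         \<le> Cv * (l / real N)\<^sup>2"
    and h3: "\<kappa>0 > 0" "\<And>t. t \<in> {0..T} \<Longrightarrow> \<bar>L2_inner l (f t) \<omega>\<bar> \<ge> \<kappa>0"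
    and h4: "\<And>N M n. 2 \<le> N \<Longrightarrow> 1 \<le> M \<Longrightarrow> n < M \<Longrightarrow>
       \<bar>inner_h (l / real N) (grid_vec l N (f (t_half T M n))) (grid_vec l N \<omega>)
        - L2_inner l (f (t_half T M n)) \<omega>\<bar> \<le> CQ * (l / real N)\<^sup>2"
    and h5: "\<And>N. 2 \<le> N \<Longrightarrow> norm_h (l / real N) (A_mat l s N *\<^sub>v grid_vec l N \<omega>) \<le> C\<omega>"
       "\<And>N M n. 2 \<le> N \<Longrightarrow> 1 \<le> M \<Longrightarrow> n < M \<Longrightarrow>
          norm_h (l / real N) (grid_vec l N (f (t_half T M n))) \<le> CF"
    and h6: "Ck_on 3 T w"
    and h8: "\<And>N t. 2 \<le> N \<Longrightarrow> t \<in> {0..T} \<Longrightarrow>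
       \<bar>ivl_deriv T w t
        - inner_h (l / real N) (grid_vec l N (\<lambda>x. ivl_deriv T (\<lambda>t'. u t' x) t)) (grid_vec l N \<omega>)\<bar>
         \<le> CQ * (l / real N)\<^sup>2"
  shows "\<exists>h0>0. \<exists>\<tau>0>0. \<exists>C>0. \<forall>N M. 2 \<le> N \<longrightarrow> 1 \<le> M \<longrightarrow> l / real N \<le> h0 \<longrightarrow> T / real M \<le> \<tau>0 \<longrightarrow>
    (let h = l / real N; \<tau> = T / real M; A = A_mat l s N;
         F = (\<lambda>n. grid_vec l N (f (t_half T M n)));
         \<omega>h = grid_vec l N \<omega>
     in (\<forall>n<M. inner_h h (rec_S \<tau> A (F n)) \<omega>h \<noteq> 0) \<and>
        (\<forall>\<eta> z. (\<forall>n<M. \<bar>z n - ivl_deriv T w (t_half T M n)\<bar> \<le> \<eta>) \<longrightarrow>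
          (let U = rec_U h \<tau> A F \<omega>h z (grid_vec l N \<phi>)
           in (MAX n\<in>{..M}. norm_h h (grid_vec l N (u (real n * \<tau>)) - U n))
              + (MAX n\<in>{..<M}. \<bar>r (t_half T M n) - rec_r h \<tau> A (F n) \<omega>h (z n) (U n)\<bar>)
              \<le> C * (\<tau>\<^sup>2 + h\<^sup>2 + \<eta>))))"
proof -
  note l = \<open>l > 0\<close> and T = \<open>T > 0\<close> and s = \<open>0 < s\<close>
  have eqn: "\<And>t x. t \<in> {0..T} \<Longrightarrow> x \<in> {0<..<l} \<Longrightarrow>
      ivl_deriv T (\<lambda>t'. u t' x) t + Lu t x = r t * f t x"
    and Cu: "\<And>x. x \<in> {0<..<l} \<Longrightarrow> Ck_on 3 T (\<lambda>t. u t x)"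
    and Crf: "\<And>x. x \<in> {0<..<l} \<Longrightarrow> Ck_on 2 T (\<lambda>t. r t * f t x)"
    using \<open>sufficiently_regular l T s f u Lu r\<close> unfolding sufficiently_regular_def by blast+
  have init: "\<And>x. x \<in> {0<..<l} \<Longrightarrow> u 0 x = \<phi> x"
    using \<open>exact_solution l T f \<phi> \<omega> w u Lu r\<close> unfolding exact_solution_def by blast

  \<comment> \<open>Signs of the given constants: each bounds a nonnegative quantity, already on the
    coarsest mesh N = 2.\<close>
  have h2pos: "0 < (l / real 2)" and t0: "0 \<in> {0..T}" using l T by auto
  note nn = norm_h_nonneg[OF less_imp_le[OF h2pos]]
  have Ct: "0 \<le> Ct" using h1[OF order_refl t0] nn by (meson add_nonneg_nonneg order_trans)
  have "0 \<le> Cv * (l / real 2)\<^sup>2" using h2[OF order_refl t0] nn by (rule order_trans[rotated])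
  then have Cv: "0 \<le> Cv" using l by (simp add: zero_le_divide_iff zero_le_mult_iff)
  have "0 \<le> CQ * (l / real 2)\<^sup>2" using h8[OF order_refl t0] abs_ge_zero by (rule order_trans[rotated])
  then have CQ: "0 \<le> CQ" using l by (simp add: zero_le_divide_iff zero_le_mult_iff)
  have C\<omega>: "0 \<le> C\<omega>" using h5(1)[OF order_refl] nn by (rule order_trans[rotated])
  have CF: "0 \<le> CF" using h5(2)[OF order_refl, of 1 0] nn by (force intro: order_trans)

  \<comment> \<open>With D = \<tau>^2 + h^2 + \<eta>: \<open>W\<close> bounds the sampled weight by
    coercivity and \<open>K1\<close> D the residual. \<open>K2\<close> collects the numerator
    errors, namely \<eta>, the difference quotient, the consistency of w' and the residual.
    \<open>K3\<close> and \<open>K4\<close> arise on division by \<kappa>0 / 2, \<open>K5\<close>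
    and \<open>K6\<close> are rate and source of the recursion for the state error, and
    \<open>K7\<close> is its Gronwall bound.\<close>
  define W where "W = C\<omega> / (4 / l\<^sup>2) powr s"
  define K1 where "K1 = Ct + Cv"
  define K2 where "K2 = 1 + Ct * W + CQ + K1 * W"
  define K3 where "K3 = 2 * K2 / \<kappa>0"
  define K4 where "K4 = 2 * C\<omega> / \<kappa>0"
  define K5 where "K5 = CF * K4"
  define K6 where "K6 = CF * K3 + K1"
  define K7 where "K7 = T * exp (K5 * T) * K6"
  have W: "0 \<le> W" using C\<omega> by (simp add: W_def)
  have K1: "0 \<le> K1" using Ct Cv by (simp add: K1_def)
  have K2: "0 \<le> K2" using Ct CQ K1 W by (simp add: K2_def)
  have K3: "0 \<le> K3" using K2 h3(1) by (simp add: K3_def)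
  have K4: "0 \<le> K4" using C\<omega> h3(1) by (simp add: K4_def)
  have K5: "0 \<le> K5" using K4 CF by (simp add: K5_def)
  have K6: "0 \<le> K6" using K3 K1 CF by (simp add: K6_def)
  have K7: "0 \<le> K7" using K6 T by (simp add: K7_def)

  define C where "C = K7 + (K3 + K4 * K7) + 1"
  \<comment> \<open>The thresholds let the quadrature error and the passage from F to L^-1 F each
    cost at most \<kappa>0 / 4, so the denominator keeps \<kappa>0 / 2. The added 1 guards against
    division by zero.\<close>
  define h0 where "h0 = sqrt (\<kappa>0 / (4 * (CQ + 1)))"
  define \<tau>0 where "\<tau>0 = \<kappa>0 / (2 * (CF * C\<omega> + 1))"
  have C: "C > 0" using K3 K4 K7 unfolding C_def by (intro add_nonneg_pos add_nonneg_nonneg mult_nonneg_nonneg) auto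
  have h0: "h0 > 0" using h3(1) CQ by (simp add: h0_def)
  have \<tau>0: "\<tau>0 > 0" using h3(1) CF C\<omega> unfolding \<tau>0_def
    by (intro divide_pos_pos mult_pos_pos add_nonneg_pos mult_nonneg_nonneg) auto

  have main: "(\<forall>n<M. inner_h h (rec_S \<tau> A (F n)) \<omega>h \<noteq> 0) \<and>
        (\<forall>\<eta> z. (\<forall>n<M. \<bar>z n - ivl_deriv T w (t_half T M n)\<bar> \<le> \<eta>) \<longrightarrow>
          (MAX n\<in>{..M}. norm_h h (grid_vec l N (u (real n * \<tau>)) - rec_U h \<tau> A F \<omega>h z (grid_vec l N \<phi>) n))
              + (MAX n\<in>{..<M}. \<bar>r (t_half T M n)
                  - rec_r h \<tau> A (F n) \<omega>h (z n) (rec_U h \<tau> A F \<omega>h z (grid_vec l N \<phi>) n)\<bar>)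
              \<le> C * (\<tau>\<^sup>2 + h\<^sup>2 + \<eta>))"
    if N: "2 \<le> N" and M: "1 \<le> M" and hh0: "h \<le> h0" and \<tau>\<tau>0: "\<tau> \<le> \<tau>0"
      and defs: "h = l / real N" "\<tau> = T / real M" "A = A_mat l s N"
        "F = (\<lambda>n. grid_vec l N (f (t_half T M n)))" "\<omega>h = grid_vec l N \<omega>"
    for N M h \<tau> A F \<omega>h
  proof -
    have h: "0 < h" using l N by (simp add: defs)
    have \<tau>: "0 < \<tau>" using T M by (simp add: defs)
    interpret crank_nicolson "N - 1" h \<tau> A
      unfolding defs(3) by (rule crank_nicolson_A_mat[OF h \<tau>])
    have \<omega>hc: "\<omega>h \<in> carrier_vec (N - 1)" and Fc: "F n \<in> carrier_vec (N - 1)" for n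
      by (simp_all add: defs)
    have M\<tau>: "real M * \<tau> = T" using M by (simp add: defs)
    have th: "t_half T M n = real n * \<tau> + \<tau> / 2" for n
      by (simp add: t_half_def algebra_simps flip: defs(2))
    have times: "0 \<le> real n * \<tau>" "real n * \<tau> + \<tau> \<le> T" "t_half T M n \<in> {0..T}" if "n < M" for n
    proof -
      show 1: "0 \<le> real n * \<tau>" using \<tau> by simp
      have "real (Suc n) * \<tau> \<le> real M * \<tau>" using that \<tau> by (intro mult_right_mono) auto
      then show 2: "real n * \<tau> + \<tau> \<le> T" using M\<tau> by (simp add: algebra_simps)
      show "t_half T M n \<in> {0..T}" unfolding th using 1 2 \<tau> by auto
    qed
    have A\<omega>: "norm_h h (A *\<^sub>v \<omega>h) \<le> C\<omega>" using h5(1)[OF N] by (simp only: defs)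
    have \<omega>W: "norm_h h \<omega>h \<le> W"
    proof -
      have "(4 / l\<^sup>2) powr s * norm_h h \<omega>h \<le> C\<omega>"
        using norm_h_A_mat_ge[OF l less_imp_le[OF s] h \<omega>hc] A\<omega> unfolding defs(3) by linarith
      moreover have "(4 / l\<^sup>2) powr s > 0" using l by simp
      ultimately show ?thesis unfolding W_def by (simp add: pos_le_divide_eq mult.commute)
    qed
    have FCF: "norm_h h (F n) \<le> CF" if "n < M" for n
      using h5(2)[OF N M that] by (simp only: defs)

    have den: "\<bar>inner_h h (rec_S \<tau> A (F n)) \<omega>h\<bar> \<ge> \<kappa>0 / 2" if n: "n < M" for n
    proof -
      have "CQ * h\<^sup>2 \<le> \<kappa>0 / 4"
      proof -
        have "h\<^sup>2 \<le> h0\<^sup>2" using hh0 h by (intro power_mono) auto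
        also have "\<dots> = \<kappa>0 / (4 * (CQ + 1))" using h3(1) CQ by (simp add: h0_def)
        finally have "(CQ + 1) * h\<^sup>2 \<le> \<kappa>0 / 4" using CQ by (simp add: field_simps)
        then show ?thesis using zero_le_power2[of h] distrib_right[of CQ 1 "h\<^sup>2"] by linarith
      qed
      then have 1: "\<bar>inner_h h (F n) \<omega>h - L2_inner l (f (t_half T M n)) \<omega>\<bar> \<le> \<kappa>0 / 4"
        using h4[OF N M n] unfolding defs(1,4,5) by linarith
      have "norm_h h (F n) * norm_h h (A *\<^sub>v \<omega>h) \<le> CF * C\<omega>"
        using FCF[OF n] A\<omega> CF h by (intro mult_mono norm_h_nonneg) auto
      then have "\<tau> / 2 * (norm_h h (F n) * norm_h h (A *\<^sub>v \<omega>h)) \<le> \<tau> / 2 * (CF * C\<omega>)"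
        using \<tau> by (intro mult_left_mono) auto
      also have "\<dots> \<le> \<kappa>0 / 4"
      proof -
        have p: "0 < CF * C\<omega> + 1" using CF C\<omega> by (simp add: add_nonneg_pos)
        then have "\<tau> * (2 * (CF * C\<omega> + 1)) \<le> \<kappa>0"
          using \<tau>\<tau>0 by (simp add: \<tau>0_def pos_le_divide_eq)
        moreover have "\<tau> * (2 * (CF * C\<omega> + 1)) = 4 * (\<tau> / 2 * (CF * C\<omega>)) + 2 * \<tau>"
          by (simp add: distrib_left)
        ultimately show ?thesis using \<tau> by linarith
      qed
      finally have "\<bar>inner_h h (rec_S \<tau> A (F n)) \<omega>h - inner_h h (F n) \<omega>h\<bar> \<le> \<kappa>0 / 4"
        using denominator_close[OF Fc \<omega>hc] by (rule order_trans[rotated])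
      then show ?thesis using 1 h3(2)[OF times(3)[OF n]] by linarith
    qed

    show ?thesis
    proof (intro conjI allI impI)
      fix n assume "n < M"
      then show "inner_h h (rec_S \<tau> A (F n)) \<omega>h \<noteq> 0" using den[of n] h3(1) by auto
    next
      fix \<eta> :: real and z :: "nat \<Rightarrow> real"
      assume z: "\<forall>n<M. \<bar>z n - ivl_deriv T w (t_half T M n)\<bar> \<le> \<eta>"
      \<comment> \<open>Since M >= 1, the index 0 occurs and its bound forces the sign.\<close>
      have \<eta>: "0 \<le> \<eta>" using z[rule_format, of 0] M by linarith
      define U where "U = rec_U h \<tau> A F \<omega>h z (grid_vec l N \<phi>)"
      define D where "D = \<tau>\<^sup>2 + h\<^sup>2 + \<eta>"
      define e where "e n = norm_h h (grid_vec l N (u (real n * \<tau>)) - U n)" for n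
      define \<delta> where "\<delta> n = \<bar>r (t_half T M n) - rec_r h \<tau> A (F n) \<omega>h (z n) (U n)\<bar>" for n
      have D: "0 \<le> D" using \<eta> by (simp add: D_def)
      have Uc: "U n \<in> carrier_vec (N - 1)" for n
        unfolding U_def by (rule rec_U_carrier[OF Fc grid_vec_carrier])
      have USuc: "U (Suc n) = rec_Y \<tau> A (U n) + (\<tau> * rec_r h \<tau> A (F n) \<omega>h (z n) (U n)) \<cdot>\<^sub>v rec_S \<tau> A (F n)" for n
        by (simp add: U_def Let_def)
      have e_nonneg: "0 \<le> e n" for n unfolding e_def using h by (intro norm_h_nonneg) simp

      have step: "\<delta> n \<le> K3 * D + K4 * e n" "e (Suc n) \<le> (1 + \<tau> * K5) * e n + \<tau> * (K6 * D)"
        if n: "n < M" for n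
      proof -
        let ?x = "grid_vec l N (u (real n * \<tau>))"
        let ?x1 = "grid_vec l N (u (real n * \<tau> + \<tau>))"
        let ?b = "t_half T M n"
        let ?d = "(1 / \<tau>) \<cdot>\<^sub>v (?x1 - ?x)"
        let ?ut = "grid_vec l N (\<lambda>x. ivl_deriv T (\<lambda>t'. u t' x) ?b)"
        define \<rho> where "\<rho> = ?d + (1 / 2) \<cdot>\<^sub>v (A *\<^sub>v ?x1 + A *\<^sub>v ?x) - r ?b \<cdot>\<^sub>v F n"
        have \<rho>c: "\<rho> \<in> carrier_vec (N - 1)" using Fc by (simp add: \<rho>_def del: One_nat_def)
        note trunc = Crank_Nicolson_truncation[OF l T less_imp_le[OF h] \<tau> times(1,2)[OF n] th[of n] A eqn Cu Crf
            h1[OF N, folded defs(1)] h2[OF N, folded defs(1,3)]]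
        have \<alpha>: "norm_h h (?d - ?ut) \<le> Ct * \<tau>\<^sup>2 / 8" by (rule trunc(1)) simp_all
        have \<rho>: "norm_h h \<rho> \<le> Ct * \<tau>\<^sup>2 + Cv * h\<^sup>2" unfolding \<rho>_def defs(4) by (rule trunc(2)) simp_all
        have scheme: "?d + (1 / 2) \<cdot>\<^sub>v (A *\<^sub>v ?x1 + A *\<^sub>v ?x) = r ?b \<cdot>\<^sub>v F n + \<rho>"
          unfolding \<rho>_def using Fc[of n] A by (intro eq_vecI) (auto simp del: index_mult_mat_vec)
        have parts: "\<tau>\<^sup>2 \<le> D" "h\<^sup>2 \<le> D" "\<tau>\<^sup>2 + h\<^sup>2 \<le> D" "\<eta> \<le> D" using \<eta> by (simp_all add: D_def)
        have \<rho>D: "norm_h h \<rho> \<le> K1 * D"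
          using \<rho> mult_left_mono[OF parts(1) Ct] mult_left_mono[OF parts(2) Cv] by (simp add: K1_def distrib_right)
        have \<rho>W: "norm_h h \<rho> * norm_h h \<omega>h \<le> K1 * D * W"
          using \<rho>D \<omega>W h by (intro mult_mono norm_h_nonneg mult_nonneg_nonneg K1 D) auto
        \<comment> \<open>Three comparisons, all at the midpoint: the difference quotient with u_t,
          the tested u_t with w', and w' with z.\<close>
        have data: "\<bar>inner_h h ?d \<omega>h - z n\<bar> \<le> Ct * W * D + CQ * h\<^sup>2 + \<eta>"
        proof -
          have "\<bar>inner_h h (?d - ?ut) \<omega>h\<bar> \<le> norm_h h (?d - ?ut) * norm_h h \<omega>h"
            using h \<omega>hc by (intro inner_h_Cauchy_Schwarz[of _ _ "N - 1"]) auto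
          also have "\<dots> \<le> (Ct * D) * W"
          proof (rule mult_mono)
            have "Ct * \<tau>\<^sup>2 \<le> Ct * D" "0 \<le> Ct * \<tau>\<^sup>2" using mult_left_mono[OF parts(1) Ct] Ct by auto
            then show "norm_h h (?d - ?ut) \<le> Ct * D" using \<alpha> by linarith
          qed (use \<omega>W Ct D h in \<open>auto intro: norm_h_nonneg\<close>)
          finally have "\<bar>inner_h h ?d \<omega>h - inner_h h ?ut \<omega>h\<bar> \<le> Ct * W * D"
            using \<omega>hc by (simp add: inner_h_minus_left[of _ "N - 1"] mult_ac)
          moreover have "\<bar>ivl_deriv T w ?b - inner_h h ?ut \<omega>h\<bar> \<le> CQ * h\<^sup>2"
            using h8[OF N times(3)[OF n]] by (simp only: defs)
          moreover have "\<bar>z n - ivl_deriv T w ?b\<bar> \<le> \<eta>" using z n by blast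
          ultimately show ?thesis by linarith
        qed
        have nz: "inner_h h (rec_S \<tau> A (F n)) \<omega>h \<noteq> 0" using den[OF n] h3(1) by auto
        have "norm_h h (?x - U n) * norm_h h (A *\<^sub>v \<omega>h) \<le> e n * C\<omega>"
          using A\<omega> e_nonneg[of n] by (simp add: e_def mult_left_mono)
        then have "\<delta> n * \<bar>inner_h h (rec_S \<tau> A (F n)) \<omega>h\<bar>
            \<le> Ct * W * D + CQ * h\<^sup>2 + \<eta> + e n * C\<omega> + K1 * D * W"
          using source_error[OF grid_vec_carrier grid_vec_carrier Fc \<omega>hc \<rho>c Uc[of n] scheme nz, of "z n"]
            data \<rho>W unfolding \<delta>_def by linarith
        moreover have "CQ * h\<^sup>2 \<le> CQ * D" by (rule mult_left_mono[OF parts(2) CQ])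
        moreover have "\<delta> n * (\<kappa>0 / 2) \<le> \<delta> n * \<bar>inner_h h (rec_S \<tau> A (F n)) \<omega>h\<bar>"
          using den[OF n] by (intro mult_left_mono) (auto simp: \<delta>_def)
        moreover have "K2 * D + C\<omega> * e n = D + Ct * W * D + CQ * D + K1 * D * W + e n * C\<omega>"
          by (simp add: K2_def algebra_simps)
        ultimately have "\<delta> n * (\<kappa>0 / 2) \<le> K2 * D + C\<omega> * e n"
          using parts(4) by linarith
        then show \<delta>: "\<delta> n \<le> K3 * D + K4 * e n"
          using h3(1) by (simp add: K3_def K4_def field_simps)
        have "e (Suc n) = norm_h h (?x1 - U (Suc n))" by (simp add: e_def algebra_simps)
        also have "\<dots> \<le> e n + \<tau> * (\<delta> n * norm_h h (F n) + norm_h h \<rho>)"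
          unfolding USuc e_def \<delta>_def
          by (rule state_error[OF grid_vec_carrier grid_vec_carrier Fc \<omega>hc \<rho>c Uc[of n] scheme])
        \<comment> \<open>The source error feeds back only through \<open>e n\<close>; this is where
          the rate \<open>K5\<close> = \<open>CF\<close> \<open>K4\<close> comes from.\<close>
        also have "\<dots> \<le> e n + \<tau> * ((K3 * D + K4 * e n) * CF + K1 * D)"
          using \<delta> FCF[OF n] \<rho>D \<tau> h D K3 K4 e_nonneg[of n]
          by (intro add_left_mono mult_left_mono add_mono mult_mono norm_h_nonneg) auto
        also have "\<dots> = (1 + \<tau> * K5) * e n + \<tau> * (K6 * D)"
          by (simp add: K5_def K6_def algebra_simps)
        finally show "e (Suc n) \<le> (1 + \<tau> * K5) * e n + \<tau> * (K6 * D)" .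
      qed
      \<comment> \<open>The initial condition holds on the open interval, and all grid points of the
        vector are interior.\<close>
      have "U 0 = grid_vec l N (u 0)"
        unfolding U_def using grid_vec_cong[OF l init] by simp
      then have "e 0 = 0" by (simp add: e_def norm_h_def inner_h_def scalar_prod_def)
      then have eK: "e n \<le> K7 * D" if "n \<le> M" for n
        using discrete_Gronwall[of \<tau> K5 "K6 * D" e M T n] \<tau> K5 K6 D step(2) M\<tau> that by (simp add: K7_def mult_ac)
      have \<delta>K: "\<delta> n \<le> (K3 + K4 * K7) * D" if "n < M" for n
      proof -
        have "K4 * e n \<le> K4 * (K7 * D)" using eK[of n] K4 that by (intro mult_left_mono) auto
        moreover have "(K3 + K4 * K7) * D = K3 * D + K4 * (K7 * D)" by (simp add: algebra_simps)
        ultimately show ?thesis using step(1)[OF that] by linarith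
      qed
      have "(MAX n\<in>{..M}. e n) \<le> K7 * D" using eK by (subst Max_le_iff) auto
      \<comment> \<open>\<open>M\<close> >= 1 makes the index set nonempty, as a bound on
        \<open>Max\<close> requires.\<close>
      moreover have "(MAX n\<in>{..<M}. \<delta> n) \<le> (K3 + K4 * K7) * D"
        using \<delta>K M by (subst Max_le_iff) (auto simp: lessThan_empty_iff)
      ultimately have "(MAX n\<in>{..M}. e n) + (MAX n\<in>{..<M}. \<delta> n) \<le> C * D"
        using D distrib_right[of K7 "K3 + K4 * K7" D] distrib_right[of "K7 + (K3 + K4 * K7)" 1 D]
        unfolding C_def by linarith
      then show "(MAX n\<in>{..M}. norm_h h (grid_vec l N (u (real n * \<tau>)) - rec_U h \<tau> A F \<omega>h z (grid_vec l N \<phi>) n))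
              + (MAX n\<in>{..<M}. \<bar>r (t_half T M n)
                  - rec_r h \<tau> A (F n) \<omega>h (z n) (rec_U h \<tau> A F \<omega>h z (grid_vec l N \<phi>) n)\<bar>)
              \<le> C * (\<tau>\<^sup>2 + h\<^sup>2 + \<eta>)"
        by (simp only: e_def \<delta>_def U_def D_def)
    qed
  qed
  show ?thesis
    unfolding Let_def
    by (intro exI[of _ h0] exI[of _ \<tau>0] exI[of _ C] conjI[OF h0] conjI[OF \<tau>0] conjI[OF C] allI impI)
      (rule main, simp_all)
qed

end
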